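(* Let $\widehat S\subset\{1,\dots,p\}$ be a given set with $d=|\widehat S|$, let $\xi\ge0$ and $\delta>1$ be constants, and assume: (1) $X\sim N(0,I_n\otimes\Sigma)$ and the eigenvalues of $\Phi=\Sigma^{-1}=(\phi_{ij})_{p\times p}$ lie in $[1/L,L]$ for some constant $L\ge1$; (2) $s_0(\log p)/n=o(1)$, where $s_0=\max_{1\le j\le p}|\{1\le k\le p:k\ne j,\ \phi_{jk}\ne0\}|$; (3) $d=o(n/s_0)$. Then for any $1\le j\le p$ and sufficiently large $n$, with probability at least $1-o(p^{1-\delta})$, there exists a positive constant $c^*$ such that $$F_2^{(j)}(\xi,S_{j*})\ge c^*,$$ where $F_2^{(j)}(\xi,S_{j*})$ is the sign-restricted cone invertibility factor of the residualized design matrix $\psi^{(j)}_{\widehat S^c\setminus\{j\}}$ defined in the context.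
   Context: $X=(x_1,\dots,x_p)\in\mathbb R^{n\times p}$; $X\sim N(0,I_n\otimes\Sigma)$ means that the rows of $X$ are i.i.d. $N(0,\Sigma)$. Asymptotics are as $n\to\infty$ with $p=p_n\to\infty$, and $s_0\ge1$; the constant $c^*$ does not depend on $n$. Complements $\widehat S^c$ are in $\{1,\dots,p\}$. For an index set $A$, $P_A=X_A(X_A^\top X_A)^{-1}X_A^\top$ is the projection onto the column space of $X_A$, the submatrix of $X$ with columns in $A$ ($P_\emptyset=0$). For $k\in\{j\}\cup\widehat S^c$, $\psi_k^{(j)}=(I_n-P_{\widehat S\setminus\{j\}})x_k$, and $\psi:=\psi^{(j)}_{\widehat S^c\setminus\{j\}}$ is the matrix with columns $\psi^{(j)}_k$, $k\in\widehat S^c\setminus\{j\}$. Let $S_{j*}=\{k\in\widehat S^c\setminus\{j\}:\phi_{jk}\ne0\}$ and $S_{j*}^c=\widehat S^c\setminus(\{j\}\cup S_{j*})$. The sign-restricted cone is $$\mathcal G_-^{(j)}(\xi,S_{j*})=\Big\{u\in\mathbb R^{\widehat S^c\setminus\{j\}}:\ u\neq0,\ \|u_{S_{j*}^c}\|_1\le\xi\|u_{S_{j*}}\|_1,\ u_k(\psi_k^{(j)})^\top\psi u/n\le0\ \ \forall k\in S_{j*}^c\Big\},$$ and $$F_2^{(j)}(\xi,S_{j*})=\inf\Big\{|S_{j*}|^{1/2}\,\|n^{-1}\psi^\top\psi u\|_\infty/\|u\|_2:\ u\in\mathcal G_-^{(j)}(\xi,S_{j*})\Big\}$$ (infimum over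 the empty set is $+\infty$). *)

theory Defs
  imports
    "HOL-Probability.Probability"
    "HOL-Library.Landau_Symbols"
    "Jordan_Normal_Form.Char_Poly"
    "Jordan_Normal_Form.Gauss_Jordan_Elimination"
    "Jordan_Normal_Form.DL_Submatrix"
begin

text \<open>
  Since the number of columns varies with the sample size, matrices are taken from
  Jordan_Normal_Form; indices are 0-based, so the index set 1, ..., p becomes \<open>{..<p}\<close>.
\<close>

text \<open>The law \<open>N(0, v)\<close>, parametrised by its variance; \<open>N(0, 0)\<close> is the point mass at 0.\<close>

definition centered_normal :: "real \<Rightarrow> real measure" where
  "centered_normal v =
     (if v = 0 then return borel 0 else density lborel (normal_density 0 (sqrt v)))"

text \<open>
  \<open>Y \<sim> N(0, C)\<close> in the usual sense that every linear combination \<open>a\<^sup>T Y\<close> is \<open>N(0, a\<^sup>T C a)\<close>.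
\<close>

definition gaussian_vec :: "'a measure \<Rightarrow> nat \<Rightarrow> real mat \<Rightarrow> ('a \<Rightarrow> real vec) \<Rightarrow> bool" where
  "gaussian_vec M p C Y \<longleftrightarrow>
     (\<forall>\<omega>\<in>space M. Y \<omega> \<in> carrier_vec p) \<and>
     (\<forall>a\<in>carrier_vec p.
        (\<lambda>\<omega>. scalar_prod a (Y \<omega>)) \<in> borel_measurable M \<and>
        distr M borel (\<lambda>\<omega>. scalar_prod a (Y \<omega>)) = centered_normal (scalar_prod a (C *\<^sub>v a)))"

text \<open>
  \<open>X \<sim> N(0, I\<^sub>n \<otimes> C)\<close>: independent \<open>N(0, C)\<close> rows. There is no sigma-algebra on the type of vectors,
  so independence is stated for the rows as elements of the product space \<open>PiM {..<p} borel\<close>.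
\<close>

definition gaussian_design ::
  "'a measure \<Rightarrow> nat \<Rightarrow> nat \<Rightarrow> real mat \<Rightarrow> ('a \<Rightarrow> real mat) \<Rightarrow> bool" where
  "gaussian_design M n p C X \<longleftrightarrow>
     (\<forall>\<omega>\<in>space M. X \<omega> \<in> carrier_mat n p) \<and>
     prob_space.indep_vars M (\<lambda>_. PiM {..<p} (\<lambda>_. borel))
       (\<lambda>i \<omega>. \<lambda>k\<in>{..<p}. X \<omega> $$ (i, k)) {..<n} \<and>
     (\<forall>i<n. gaussian_vec M p C (\<lambda>\<omega>. row (X \<omega>) i))"

text \<open>
  The zero matrix for singular arguments is only a totalisation: for \<open>|A| \<le> n\<close> it matters only on the null event
  that \<open>X\<^sub>A\<close> does not have full column rank.
\<close>

definition mat_inv :: "real mat \<Rightarrow> real mat" where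
  "mat_inv A = (case mat_inverse A of Some B \<Rightarrow> B | None \<Rightarrow> 0\<^sub>m (dim_row A) (dim_col A))"

definition proj_mat :: "real mat \<Rightarrow> nat set \<Rightarrow> real mat" where
  "proj_mat X A =
     (let XA = submatrix X UNIV A
      in XA * mat_inv (transpose_mat XA * XA) * transpose_mat XA)"

definition resid :: "real mat \<Rightarrow> nat set \<Rightarrow> nat \<Rightarrow> nat \<Rightarrow> real vec" where
  "resid X S j k = (1\<^sub>m (dim_row X) - proj_mat X (S - {j})) *\<^sub>v col X k"

definition coords :: "nat \<Rightarrow> nat set \<Rightarrow> nat \<Rightarrow> nat set" where
  "coords p S j = {..<p} - S - {j}"

definition nbrs :: "real mat \<Rightarrow> nat set \<Rightarrow> nat \<Rightarrow> nat set" where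
  "nbrs \<Phi> S j = {k \<in> coords (dim_row \<Phi>) S j. \<Phi> $$ (j, k) \<noteq> 0}"

definition max_degree :: "real mat \<Rightarrow> nat" where
  "max_degree \<Phi> =
     (MAX j\<in>{..<dim_row \<Phi>}. card {k. k < dim_row \<Phi> \<and> k \<noteq> j \<and> \<Phi> $$ (j, k) \<noteq> 0})"

text \<open>
  The \<open>k\<close>-th entry \<open>\<psi>\<^sub>k\<^sup>T \<psi> u / n\<close> of \<open>n\<^sup>-\<^sup>1 \<psi>\<^sup>T \<psi> u\<close>, where \<open>\<psi>\<close> has the columns
  \<open>resid X S j l\<close> for \<open>l \<in> coords p S j\<close>.
\<close>

definition gram_app :: "real mat \<Rightarrow> nat set \<Rightarrow> nat \<Rightarrow> (nat \<Rightarrow> real) \<Rightarrow> nat \<Rightarrow> real" where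
  "gram_app X S j u k =
     (\<Sum>l\<in>coords (dim_col X) S j. scalar_prod (resid X S j k) (resid X S j l) * u l)
       / real (dim_row X)"

text \<open>Below, \<open>T\<close> plays the role of \<open>S\<^sub>j\<^sub>*\<close>.\<close>

definition sign_cone ::
  "real mat \<Rightarrow> nat set \<Rightarrow> nat \<Rightarrow> real \<Rightarrow> nat set \<Rightarrow> (nat \<Rightarrow> real) set" where
  "sign_cone X S j \<xi> T =
     {u \<in> coords (dim_col X) S j \<rightarrow>\<^sub>E UNIV.
        (\<exists>k\<in>coords (dim_col X) S j. u k \<noteq> 0) \<and>
        (\<Sum>k\<in>coords (dim_col X) S j - T. \<bar>u k\<bar>) \<le> \<xi> * (\<Sum>k\<in>T. \<bar>u k\<bar>) \<and>
        (\<forall>k\<in>coords (dim_col X) S j - T. u k * gram_app X S j u k \<le> 0)}"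

definition scif2 :: "real mat \<Rightarrow> nat set \<Rightarrow> nat \<Rightarrow> real \<Rightarrow> nat set \<Rightarrow> ereal" where
  "scif2 X S j \<xi> T =
     (INF u\<in>sign_cone X S j \<xi> T.
        ereal (sqrt (real (card T)) * (MAX k\<in>coords (dim_col X) S j. \<bar>gram_app X S j u k\<bar>)
          / L2_set u (coords (dim_col X) S j)))"

end

theory Submission
  imports Defs "HOL-Real_Asymp.Real_Asymp"
begin

text \<open>
  For \<open>u\<close> in the sign-restricted cone, the sign condition gives
  \<open>u\<^sup>T G u \<le> \<parallel>u\<^sub>T\<parallel>\<^sub>1 \<parallel>G u\<parallel>\<^sub>\<infinity> \<le> |T|\<^bsup>1/2\<^esup> \<parallel>u\<parallel>\<^sub>2 \<parallel>G u\<parallel>\<^sub>\<infinity>\<close> for the residual Gram matrix \<open>G\<close>, so it suffices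
  to bound \<open>u\<^sup>T G u\<close> from below by a multiple of \<open>\<parallel>u\<parallel>\<^sub>2\<^sup>2\<close>. Now \<open>u\<^sup>T G u = \<parallel>X w\<parallel>\<^sup>2 / n\<close> for a vector \<open>w\<close>
  which agrees with \<open>u\<close> outside \<open>S\<close> and is arbitrary on \<open>S\<close>. Gaussian tail bounds on a net of
  integer vectors show that \<open>\<parallel>X w\<parallel> / \<surd>n\<close> is comparable to \<open>\<parallel>w\<parallel>\<^sub>2\<close> for all \<open>w\<close> having at most
  \<open>m = K s\<^sub>0\<close> nonzero entries outside \<open>S\<close>; the net has \<open>exp(o(n))\<close> points, each of which fails with
  probability at most \<open>2 exp(-n/2)\<close>. The passage from sparse vectors to the cone splits off the large
  entries of \<open>u\<close> and cuts the remaining ones, sorted by size, into blocks of length \<open>m\<close>.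
\<close>

section \<open>Seminorms on sparse vectors and on the cone\<close>

text \<open>The bound on \<open>d\<close> carries no factor log p, so a coordinate in
  \<open>S\<close> must not cost a factor \<open>p\<close> in the net, although \<open>w\<close> is
  arbitrary on \<open>S\<close> and the lower bound is needed there for non-sparse vectors as well.
  The net therefore treats \<open>S\<close> as a known support, at a constant factor per coordinate,
  and pays \<open>p\<close> only for the at most \<open>m\<close> positions outside it: p^m = exp(K
  s_0 log p) = exp(o(n)). No concentration near 1 is required. The crude window between 1/8 and 4
  times the expected value already gives a failure probability of order exp(-n/2) per point, against
  which the size of the net is negligible. The cone parameter \<open>\<xi>\<close> enters only
  through the block length: a larger \<open>K\<close> makes the tail of \<open>u\<close> small
  relative to its norm. Hence the constant obtained is 1/(2048 L), whatever \<open>\<xi>\<close> and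
  \<open>\<delta>\<close> are. The exceptional event is built from \<open>S\<close> alone and serves
  every \<open>j\<close> at once.\<close>

lemma ex_top_subset:
  fixes g :: "'i \<Rightarrow> real"
  assumes "finite W" "m \<le> card W"
  shows "\<exists>B\<subseteq>W. card B = m \<and> (\<forall>b\<in>B. \<forall>x\<in>W - B. g x \<le> g b)"
  using assms(2)
proof (induction m)
  case 0
  show ?case by (intro exI[of _ "{}"]) auto
next
  case (Suc m)
  then obtain B where B: "B \<subseteq> W" "card B = m" "\<forall>b\<in>B. \<forall>x\<in>W - B. g x \<le> g b"
    by auto
  have finB: "finite B" using B assms finite_subset by blast
  have ne: "W - B \<noteq> {}"
    using B Suc.prems by auto
  have "Max (g ` (W - B)) \<in> g ` (W - B)" using ne assms(1) by (intro Max_in) auto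
  then obtain y where y: "y \<in> W - B" "g y = Max (g ` (W - B))" by auto
  have "g x \<le> g y" if "x \<in> W - B" for x
    unfolding y using that assms(1) by (intro Max_ge) auto
  then show ?case
    using B finB y(1) by (intro exI[of _ "insert y B"]) auto
qed

lemma L2_set_le_sqrt_card:
  assumes "\<And>i. i \<in> A \<Longrightarrow> \<bar>v i\<bar> \<le> t" "t \<ge> 0"
  shows "L2_set v A \<le> sqrt (card A) * t"
proof -
  have "(\<Sum>i\<in>A. (v i)\<^sup>2) \<le> (\<Sum>i\<in>A. t\<^sup>2)"
    using assms by (intro sum_mono) (simp add: abs_le_square_iff[symmetric])
  then have "L2_set v A \<le> sqrt (card A * t\<^sup>2)"
    by (simp add: L2_set_def)
  then show ?thesis using assms(2) by (simp add: real_sqrt_mult)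
qed

lemma L1_le_sqrt_card_L2:
  "(\<Sum>i\<in>A. \<bar>v i\<bar>) \<le> sqrt (card A) * L2_set v A"
  using L2_set_mult_ineq[of "\<lambda>_. 1" v A] by (simp add: L2_set_def)

lemma L2_set_mono_set:
  assumes "finite B" "A \<subseteq> B"
  shows "L2_set v A \<le> L2_set v B"
  unfolding L2_set_def using assms by (intro real_sqrt_le_mono sum_mono2) auto

lemma L2_set_mono_neutral:
  assumes "finite B" "A \<subseteq> B" "\<And>i. i \<in> B - A \<Longrightarrow> v i = 0"
  shows "L2_set v A = L2_set v B"
  unfolding L2_set_def using assms by (intro arg_cong[where f=sqrt] sum.mono_neutral_left) auto

text \<open>These are the only properties of w -> |X w| / sqrt n that the deterministic argument
  uses. It is a seminorm and in general not a norm, since \<open>X\<close> has a kernel when p >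
  n.\<close>

locale fun_seminorm =
  fixes f :: "('i \<Rightarrow> real) \<Rightarrow> real"
  assumes subadd: "f (\<lambda>i. u i + v i) \<le> f u + f v"
    and homog: "f (\<lambda>i. c * u i) = \<bar>c\<bar> * f u"
begin

lemma zero [simp]: "f (\<lambda>i. 0) = 0"
  using homog[of 0 "\<lambda>i. 0"] by simp

lemma uminus: "f (\<lambda>i. - u i) = f u"
  using homog[of "-1" u] by simp

lemma nonneg: "0 \<le> f u"
  using subadd[of u "\<lambda>i. - u i"] by (simp add: uminus)

lemma sub_le: "f (\<lambda>i. u i - v i) \<le> f u + f v"
  using subadd[of u "\<lambda>i. - v i"] by (simp add: uminus)

text \<open>Peel off the \<open>m\<close> largest entries and recurse. The entry bound
  \<open>t\<close> is a parameter of the induction: for the remainder it becomes the average over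
  the block just removed.\<close>

lemma sparse_bound_imp_tail_bound:
  assumes sparse: "\<And>v B. B \<subseteq> V \<Longrightarrow> card B \<le> m \<Longrightarrow> (\<And>i. i \<notin> B \<Longrightarrow> v i = 0) \<Longrightarrow> f v \<le> \<Lambda> * L2_set v B"
    and m: "m > 0" and \<Lambda>: "\<Lambda> \<ge> 0" and V: "finite V"
    and W: "W \<subseteq> V" and supp: "\<And>i. i \<notin> W \<Longrightarrow> v i = 0"
    and t: "\<And>i. i \<in> W \<Longrightarrow> \<bar>v i\<bar> \<le> t" "t \<ge> 0"
  shows "f v \<le> \<Lambda> * (sqrt m * t + (\<Sum>i\<in>W. \<bar>v i\<bar>) / sqrt m)"
proof -
  have "finite W" using V W finite_subset by blast
  then show ?thesis using W supp t
  proof (induction arbitrary: v t rule: finite_psubset_induct)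
    case (psubset W)
    show ?case
    proof (cases "card W \<le> m")
      case True
      have "f v \<le> \<Lambda> * L2_set v W" using psubset.prems True by (intro sparse) auto
      also have "L2_set v W \<le> sqrt (card W) * t"
        using psubset.prems by (intro L2_set_le_sqrt_card) auto
      also have "sqrt (card W) * t \<le> sqrt m * t"
        using True psubset.prems by (intro mult_right_mono) auto
      also have "\<dots> \<le> sqrt m * t + (\<Sum>i\<in>W. \<bar>v i\<bar>) / sqrt m"
        by (simp add: sum_nonneg)
      finally show ?thesis using \<Lambda> by (simp add: mult_left_mono)
    next
      case False
      then have "m \<le> card W" by simp
      from ex_top_subset[OF psubset.hyps this, of "\<lambda>i. \<bar>v i\<bar>"]
      obtain B where B: "B \<subseteq> W" "card B = m" "\<forall>b\<in>B. \<forall>x\<in>W - B. \<bar>v x\<bar> \<le> \<bar>v b\<bar>"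
        by blast
      have finB: "finite B" using B(1) psubset.hyps by (rule finite_subset)
      define q where "q = (\<lambda>i. if i \<in> B then v i else 0)"
      define r where "r = (\<lambda>i. if i \<in> B then 0 else v i)"
      \<comment> \<open>The average over the block dominates every later entry. Moreover sqrt m * s
        is exactly the share of \<open>B\<close> in the l1 term, so the block contributions add up
        to the full l1 norm.\<close>
      define s where "s = (\<Sum>i\<in>B. \<bar>v i\<bar>) / m"
      have "f v = f (\<lambda>i. q i + r i)"
        by (intro arg_cong[where f=f]) (auto simp: q_def r_def)
      also have "\<dots> \<le> f q + f r" by (rule subadd)
      also have "f q \<le> \<Lambda> * L2_set q B"
        using B psubset.prems by (intro sparse) (auto simp: q_def)
      also have "L2_set q B \<le> sqrt (card B) * t"
        using B psubset.prems by (intro L2_set_le_sqrt_card) (auto simp: q_def)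
      also have "f r \<le> \<Lambda> * (sqrt m * s + (\<Sum>i\<in>W - B. \<bar>r i\<bar>) / sqrt m)"
      proof (rule psubset.IH)
        have "B \<noteq> {}" using B(2) m by auto
        then show "W - B \<subset> W" using B(1) by blast
        show "W - B \<subseteq> V" using psubset.prems by auto
        show "0 \<le> s" by (auto simp: s_def sum_nonneg)
        show "r i = 0" if "i \<notin> W - B" for i using that psubset.prems by (auto simp: r_def)
        show "\<bar>r i\<bar> \<le> s" if "i \<in> W - B" for i
        proof -
          have "m * \<bar>v i\<bar> = (\<Sum>b\<in>B. \<bar>v i\<bar>)" using B by simp
          also have "\<dots> \<le> (\<Sum>b\<in>B. \<bar>v b\<bar>)" using B that by (intro sum_mono) auto
          finally show ?thesis using that m by (auto simp: s_def r_def field_simps)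
        qed
      qed
      also have "sqrt m * s = (\<Sum>i\<in>B. \<bar>v i\<bar>) / sqrt m"
        using m by (simp add: s_def field_simps)
      also have "(\<Sum>i\<in>W - B. \<bar>r i\<bar>) = (\<Sum>i\<in>W - B. \<bar>v i\<bar>)"
        by (intro sum.cong) (auto simp: r_def)
      also have "(\<Sum>i\<in>B. \<bar>v i\<bar>) / sqrt m + (\<Sum>i\<in>W - B. \<bar>v i\<bar>) / sqrt m = (\<Sum>i\<in>W. \<bar>v i\<bar>) / sqrt m"
        using B psubset.hyps by (simp add: sum.subset_diff[of B W] add_divide_distrib)
      finally show ?thesis using B \<Lambda> by (simp add: distrib_left mult_left_mono)
    qed
  qed
qed

text \<open>Round a vector of the unit ball to the lattice of mesh h = \<open>\<epsilon>\<close> /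
  sqrt k; the error has l2 norm at most \<open>\<epsilon>\<close>. By homogeneity, bounds at integer
  vectors suffice. The upper bound comes from a self-bounding inequality for the supremum
  \<open>Q\<close> over the ball, and the lower bound then follows by the triangle
  inequality.\<close>

lemma net_bounds:
  fixes U :: "'i set" and \<epsilon> l \<Lambda> K :: real
  assumes U: "finite U" "card U \<le> k" and k: "k > 0"
    and eps: "0 < \<epsilon>" "\<epsilon> \<le> 1/2" "12 * \<Lambda> * \<epsilon> \<le> l" and l: "l \<ge> 0" and \<Lambda>: "\<Lambda> \<ge> 0"
    and K: "\<And>w. (\<And>i. i \<notin> U \<Longrightarrow> w i = 0) \<Longrightarrow> f w \<le> K * L2_set w U"
    and net: "\<And>z :: 'i \<Rightarrow> int. (\<And>i. i \<notin> U \<Longrightarrow> z i = 0) \<Longrightarrow>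
        real_of_int (\<Sum>i\<in>U. \<bar>z i\<bar>) \<le> (1 / \<epsilon>\<^sup>2 + 2) * k \<Longrightarrow>
        l * L2_set (\<lambda>i. real_of_int (z i)) U \<le> f (\<lambda>i. real_of_int (z i)) \<and>
        f (\<lambda>i. real_of_int (z i)) \<le> \<Lambda> * L2_set (\<lambda>i. real_of_int (z i)) U"
    and w: "\<And>i. i \<notin> U \<Longrightarrow> w i = 0"
  shows "f w \<le> 3 * \<Lambda> * L2_set w U" "l / 4 * L2_set w U \<le> f w"
proof -
  define D where "D = {w. (\<forall>i. i \<notin> U \<longrightarrow> w i = 0) \<and> L2_set w U \<le> 1}"
  define h where "h = \<epsilon> / sqrt k"
  have h: "h > 0" using eps k by (simp add: h_def)
  have approx: "\<exists>z r. w = (\<lambda>i. h * z i + r i) \<and>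
      (\<forall>i. i \<notin> U \<longrightarrow> r i = 0) \<and> L2_set r U \<le> \<epsilon> \<and>
      l * L2_set z U \<le> f z \<and> f z \<le> \<Lambda> * L2_set z U" if "w \<in> D" for w
  proof -
    define z where "z = (\<lambda>i. \<lfloor>w i / h\<rfloor>)"
    define r where "r = (\<lambda>i. w i - h * real_of_int (z i))"
    have z0: "z i = 0" if "i \<notin> U" for i using that \<open>w \<in> D\<close> by (auto simp: z_def D_def)
    have "\<bar>r i\<bar> \<le> h" for i
    proof -
      have "\<bar>w i / h - real_of_int (z i)\<bar> \<le> 1" unfolding z_def by linarith
      then have "h * \<bar>w i / h - real_of_int (z i)\<bar> \<le> h * 1" using h by (intro mult_left_mono) auto
      moreover have "h * \<bar>w i / h - real_of_int (z i)\<bar> = \<bar>r i\<bar>"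
        using h abs_mult[of h "w i / h - real_of_int (z i)"] by (simp add: r_def right_diff_distrib)
      ultimately show ?thesis by simp
    qed
    then have "L2_set r U \<le> sqrt (card U) * h"
      using h by (intro L2_set_le_sqrt_card) auto
    also have "\<dots> \<le> sqrt k * h" using U h by (intro mult_right_mono) auto
    also have "\<dots> = \<epsilon>" using k by (simp add: h_def)
    finally have r: "L2_set r U \<le> \<epsilon>" .
    \<comment> \<open>Passing from |x| to x^2 + 1 converts the l2 bound into an l1 bound on
      \<open>z\<close>; rounding and this conversion cost 1 each per coordinate. This is the origin
      of the radius (1 / \<open>\<epsilon>\<close>^2 + 2) * k of the net.\<close>
    have "real_of_int \<bar>z i\<bar> \<le> (w i)\<^sup>2 / h\<^sup>2 + 2" for i
    proof -
      have "real_of_int \<bar>z i\<bar> \<le> \<bar>w i / h\<bar> + 1" unfolding z_def by linarith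
      also have "\<bar>x\<bar> \<le> x\<^sup>2 + 1" for x :: real
        using zero_le_power2[of "\<bar>x\<bar> - 1/2"] by (simp add: power2_eq_square algebra_simps)
      finally show ?thesis by (simp add: power_divide)
    qed
    then have "real_of_int (\<Sum>i\<in>U. \<bar>z i\<bar>) \<le> (\<Sum>i\<in>U. (w i)\<^sup>2 / h\<^sup>2 + 2)"
      unfolding of_int_sum by (intro sum_mono)
    also have "\<dots> = (\<Sum>i\<in>U. (w i)\<^sup>2) / h\<^sup>2 + 2 * card U"
      by (simp add: sum.distrib sum_divide_distrib)
    also have "(\<Sum>i\<in>U. (w i)\<^sup>2) / h\<^sup>2 \<le> 1 / h\<^sup>2"
      using that by (intro divide_right_mono) (auto simp: D_def L2_set_def)
    also have "1 / h\<^sup>2 = k / \<epsilon>\<^sup>2" using k by (simp add: h_def power_divide)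
    also have "k / \<epsilon>\<^sup>2 + 2 * card U \<le> (1 / \<epsilon>\<^sup>2 + 2) * k"
      using U by (simp add: algebra_simps)
    finally have "real_of_int (\<Sum>i\<in>U. \<bar>z i\<bar>) \<le> (1 / \<epsilon>\<^sup>2 + 2) * k" by simp
    from net[OF z0 this] r show ?thesis
      using z0 that
      by (intro exI[of _ "\<lambda>i. real_of_int (z i)"] exI[of _ r]) (auto simp: r_def D_def)
  qed
  \<comment> \<open>Absorbing the term \<open>\<epsilon> * Q\<close> below is meaningful only for a
    finite supremum. The constant \<open>K\<close> serves this purpose alone and does not enter the
    conclusion.\<close>
  have bdd: "bdd_above (f ` D)"
  proof (rule bdd_aboveI2)
    show "f w \<le> max K 0" if "w \<in> D" for w
    proof -
      have "f w \<le> K * L2_set w U" using that by (intro K) (auto simp: D_def)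
      also have "\<dots> \<le> max K 0 * L2_set w U" by (intro mult_right_mono) auto
      also have "\<dots> \<le> max K 0 * 1" using that by (intro mult_left_mono) (auto simp: D_def)
      finally show ?thesis by simp
    qed
  qed
  have D0: "(\<lambda>i. 0) \<in> D" by (auto simp: D_def L2_set_def)
  define Q where "Q = Sup (f ` D)"
  have Qge: "f w \<le> Q" if "w \<in> D" for w
    unfolding Q_def using bdd that by (intro cSup_upper) auto
  have Q_scale: "f w \<le> Q * L2_set w U" if w: "\<And>i. i \<notin> U \<Longrightarrow> w i = 0" for w
  proof (cases "L2_set w U = 0")
    case True
    then have "w = (\<lambda>i. 0)" using w U by (auto simp: L2_set_eq_0_iff fun_eq_iff)
    then show ?thesis using True by simp
  next
    case False
    then have pos: "L2_set w U > 0" by (simp add: order_less_le)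
    have "L2_set (\<lambda>i. 1 / L2_set w U * w i) U = 1"
      using pos L2_set_right_distrib[of "1 / L2_set w U" w U] by simp
    then have "(\<lambda>i. 1 / L2_set w U * w i) \<in> D"
      using w by (simp add: D_def)
    from Qge[OF this] have "1 / L2_set w U * f w \<le> Q"
      unfolding homog using pos by simp
    then show ?thesis using pos by (simp add: field_simps)
  qed
  have znorm: "h * L2_set z U \<le> L2_set w U + L2_set r U" "L2_set w U \<le> h * L2_set z U + L2_set r U"
    if "w = (\<lambda>i. h * z i + r i)" for w z r
  proof -
    have eq: "h * L2_set z U = L2_set (\<lambda>i. h * z i) U" using h by (simp add: L2_set_right_distrib)
    show "L2_set w U \<le> h * L2_set z U + L2_set r U"
      unfolding that eq by (rule L2_set_triangle_ineq)
    have "L2_set (\<lambda>i. w i + (- r i)) U \<le> L2_set w U + L2_set (\<lambda>i. - r i) U"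
      by (rule L2_set_triangle_ineq)
    then show "h * L2_set z U \<le> L2_set w U + L2_set r U"
      unfolding eq that by (simp add: L2_set_def)
  qed
  have Q0: "Q \<ge> 0" using Qge[OF D0] by simp
  have "f w \<le> \<Lambda> * (1 + \<epsilon>) + \<epsilon> * Q" if wD: "w \<in> D" for w
  proof -
    obtain z r where zr: "w = (\<lambda>i. h * z i + r i)" "\<And>i. i \<notin> U \<Longrightarrow> r i = 0" "L2_set r U \<le> \<epsilon>"
      "f z \<le> \<Lambda> * L2_set z U" using approx[OF wD] by blast
    have "f w \<le> h * f z + f r"
      using subadd[of "\<lambda>i. h * z i" r] homog[of h z] h zr by simp
    also have "f r \<le> Q * L2_set r U" using zr by (intro Q_scale) auto
    also have "\<dots> \<le> Q * \<epsilon>" using zr Q0 by (intro mult_left_mono)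
    also have "h * f z \<le> h * (\<Lambda> * L2_set z U)" using zr h by (intro mult_left_mono) auto
    also have "\<dots> = \<Lambda> * (h * L2_set z U)" by simp
    also have "\<dots> \<le> \<Lambda> * (1 + \<epsilon>)"
      using znorm(1)[OF zr(1)] zr(3) wD \<Lambda> by (intro mult_left_mono) (auto simp: D_def)
    finally show ?thesis by (simp add: mult.commute)
  qed
  \<comment> \<open>With \<open>\<epsilon>\<close> <= 1/2 this reads Q <= 3/2 *
    \<open>\<Lambda>\<close> + Q/2, hence the factor 3.\<close>
  then have "Q \<le> \<Lambda> * (1 + \<epsilon>) + \<epsilon> * Q"
    unfolding Q_def using D0 by (intro cSup_least) auto
  moreover have "\<epsilon> * Q \<le> 1/2 * Q" using eps(2) Q0 by (rule mult_right_mono)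
  moreover have "\<Lambda> * \<epsilon> \<le> \<Lambda> * (1/2)" using eps(2) \<Lambda> by (rule mult_left_mono)
  ultimately have Q3: "Q \<le> 3 * \<Lambda>" by (simp add: distrib_left)
  show "f w \<le> 3 * \<Lambda> * L2_set w U"
  proof -
    have "f w \<le> Q * L2_set w U" using w by (rule Q_scale)
    also have "\<dots> \<le> 3 * \<Lambda> * L2_set w U" using Q3 by (intro mult_right_mono) auto
    finally show ?thesis .
  qed
  show "l / 4 * L2_set w U \<le> f w"
  proof (cases "L2_set w U = 0")
    case True
    then show ?thesis using nonneg by simp
  next
    case False
    then have pos: "L2_set w U > 0" by (simp add: order_less_le)
    define v where "v = (\<lambda>i. 1 / L2_set w U * w i)"
    have v1: "L2_set v U = 1"
      unfolding v_def using pos L2_set_right_distrib[of "1 / L2_set w U" w U] by simp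
    then have vD: "v \<in> D"
      using w by (simp add: D_def v_def)
    obtain z r where zr: "v = (\<lambda>i. h * z i + r i)" "\<And>i. i \<notin> U \<Longrightarrow> r i = 0" "L2_set r U \<le> \<epsilon>"
      "l * L2_set z U \<le> f z" using approx[OF vD] by blast
    have "h * f z \<le> f v + f r"
      using sub_le[of v r] homog[of h z] h zr(1) by simp
    moreover have "f r \<le> 3 * \<Lambda> * \<epsilon>"
    proof -
      have "f r \<le> Q * L2_set r U" using zr by (intro Q_scale) auto
      also have "\<dots> \<le> 3 * \<Lambda> * \<epsilon>" using zr Q3 \<Lambda> by (intro mult_mono) auto
      finally show ?thesis .
    qed
    moreover have "l * (1 - \<epsilon>) \<le> h * f z"
    proof -
      have "l * (1 - \<epsilon>) \<le> l * (h * L2_set z U)"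
        using znorm(2)[OF zr(1)] zr(3) v1 l by (intro mult_left_mono) auto
      also have "\<dots> = h * (l * L2_set z U)" by simp
      also have "\<dots> \<le> h * f z" using zr h by (intro mult_left_mono) auto
      finally show ?thesis .
    qed
    \<comment> \<open>The main part is at least l/2 and the rounding error costs at most 3 *
      \<open>\<Lambda>\<close> * \<open>\<epsilon>\<close> <= l/4, which explains the 12 in the
      hypothesis.\<close>
    moreover have "l * (1/2) \<le> l * (1 - \<epsilon>)" using l eps by (intro mult_left_mono) auto
    ultimately have "l / 4 \<le> f v" using eps by simp
    also have "f v = 1 / L2_set w U * f w" unfolding v_def homog using pos by simp
    finally show ?thesis using pos by (simp add: field_simps)
  qed
qed

text \<open>On the cone the l1 norm over \<open>C\<close> is at most (1 + \<open>\<xi>\<close>) sqrt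
  s times the l2 norm \<open>N\<close>. If \<open>m\<close> is large compared with \<open>s\<close>,
  the part of \<open>w\<close> outside its large entries is then of order \<open>\<eta>\<close> * N,
  both in l2 and under \<open>f\<close>, and cannot cancel the lower bound for the sparse part. Only
  the norm over \<open>C\<close> is bounded below, because the cone says nothing about
  \<open>w\<close> on \<open>A\<close>.\<close>

lemma restricted_eigenvalue:
  fixes l \<Lambda> \<eta> \<xi> :: real and s m :: nat
  assumes fin: "finite A" "finite C" and disj: "A \<inter> C = {}" and T: "T \<subseteq> C" "card T \<le> s"
    and m: "m > 0" and \<Lambda>: "\<Lambda> \<ge> 0" and l: "l \<ge> 0" and xi: "\<xi> \<ge> 0"
    and eta: "(1 + \<xi>) * sqrt s \<le> \<eta> * sqrt m" "\<eta> \<le> 1/2" "8 * \<Lambda> * \<eta> \<le> l"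
    and lower: "\<And>v B. B \<subseteq> C \<Longrightarrow> card B \<le> m \<Longrightarrow> (\<And>i. i \<notin> A \<union> B \<Longrightarrow> v i = 0) \<Longrightarrow>
      l * L2_set v (A \<union> B) \<le> f v"
    and upper: "\<And>v B. B \<subseteq> C \<Longrightarrow> card B \<le> m \<Longrightarrow> (\<And>i. i \<notin> B \<Longrightarrow> v i = 0) \<Longrightarrow>
      f v \<le> \<Lambda> * L2_set v B"
    and supp: "\<And>i. i \<notin> A \<union> C \<Longrightarrow> w i = 0"
    and cone: "(\<Sum>k\<in>C - T. \<bar>w k\<bar>) \<le> \<xi> * (\<Sum>k\<in>T. \<bar>w k\<bar>)"
  shows "l / 4 * L2_set w C \<le> f w"
proof -
  define N where "N = L2_set w C"
  define a where "a = (\<Sum>k\<in>C. \<bar>w k\<bar>)"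
  \<comment> \<open>At most \<open>m\<close> entries exceed a / m by Markov's inequality, and
    entries below it have l2 norm at most sqrt (t * a) = a / sqrt m. If a = 0, the strict inequality
    in \<open>B\<close> makes \<open>B\<close> empty.\<close>
  define t where "t = a / m"
  have N0: "N \<ge> 0" by (simp add: N_def)
  have a0: "a \<ge> 0" "t \<ge> 0" by (auto simp: a_def t_def sum_nonneg)
  have "a = (\<Sum>k\<in>C - T. \<bar>w k\<bar>) + (\<Sum>k\<in>T. \<bar>w k\<bar>)"
    unfolding a_def using T fin by (intro sum.subset_diff) auto
  also have "\<dots> \<le> (1 + \<xi>) * (\<Sum>k\<in>T. \<bar>w k\<bar>)" using cone by (simp add: algebra_simps)
  also have "(\<Sum>k\<in>T. \<bar>w k\<bar>) \<le> sqrt (card T) * L2_set w T" by (rule L1_le_sqrt_card_L2)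
  also have "\<dots> \<le> sqrt s * N"
    unfolding N_def using T fin by (intro mult_mono L2_set_mono_set) auto
  finally have "a \<le> (1 + \<xi>) * sqrt s * N" using xi by (simp add: mult_left_mono)
  also have "\<dots> \<le> \<eta> * sqrt m * N" using eta N0 by (intro mult_right_mono)
  finally have a: "a / sqrt m \<le> \<eta> * N" using m by (simp add: field_simps)
  define B where "B = {k \<in> C. \<bar>w k\<bar> > t}"
  have BC: "B \<subseteq> C" "finite B" using fin by (auto simp: B_def)
  have cardB: "card B \<le> m"
  proof (cases "a = 0")
    case True
    then have "\<forall>k\<in>C. w k = 0" using fin by (simp add: a_def sum_nonneg_eq_0_iff)
    then have "B = {}" using a0 by (auto simp: B_def)
    then show ?thesis by simp
  next
    case False
    then have t: "t > 0" using a0 m by (simp add: t_def)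
    have "card B * t = (\<Sum>k\<in>B. t)" by simp
    also have "\<dots> \<le> (\<Sum>k\<in>B. \<bar>w k\<bar>)" by (intro sum_mono) (auto simp: B_def)
    also have "\<dots> \<le> a" unfolding a_def using BC fin by (intro sum_mono2) auto
    also have "\<dots> = m * t" using m by (simp add: t_def)
    finally show ?thesis using t by simp
  qed
  define q where "q = (\<lambda>i. if i \<in> A \<union> B then w i else 0)"
  define r where "r = (\<lambda>i. if i \<in> C - B then w i else 0)"
  have wqr: "w = (\<lambda>i. q i + r i)" using supp disj BC by (auto simp: q_def r_def fun_eq_iff)
  have sumr: "(\<Sum>i\<in>C - B. \<bar>r i\<bar>) \<le> a"
  proof -
    have "(\<Sum>i\<in>C - B. \<bar>r i\<bar>) = (\<Sum>i\<in>C - B. \<bar>w i\<bar>)" by (intro sum.cong) (auto simp: r_def)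
    also have "\<dots> \<le> a" unfolding a_def using fin by (intro sum_mono2) auto
    finally show ?thesis .
  qed
  have tsq: "sqrt m * t = a / sqrt m" using m by (simp add: t_def field_simps)
  have "f r \<le> \<Lambda> * (sqrt m * t + (\<Sum>i\<in>C - B. \<bar>r i\<bar>) / sqrt m)"
    by (rule sparse_bound_imp_tail_bound[where V=C])
      (use upper m \<Lambda> fin a0 in \<open>auto simp: r_def B_def\<close>)
  also have "\<dots> \<le> \<Lambda> * (a / sqrt m + a / sqrt m)"
    unfolding tsq using sumr \<Lambda> by (intro mult_left_mono add_left_mono divide_right_mono) auto
  also have "\<dots> \<le> \<Lambda> * (2 * (\<eta> * N))" using a \<Lambda> by (intro mult_left_mono) auto
  finally have fr: "f r \<le> \<Lambda> * (2 * (\<eta> * N))" .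
  have "L2_set r C \<le> a / sqrt m"
  proof -
    have "(\<Sum>i\<in>C. (r i)\<^sup>2) = (\<Sum>i\<in>C - B. (r i)\<^sup>2)"
      using fin by (intro sum.mono_neutral_right) (auto simp: r_def)
    also have "\<dots> \<le> (\<Sum>i\<in>C - B. t * \<bar>r i\<bar>)"
    proof (intro sum_mono)
      fix i assume "i \<in> C - B"
      then have "\<bar>r i\<bar> \<le> t" by (auto simp: r_def B_def)
      then have "\<bar>r i\<bar> * \<bar>r i\<bar> \<le> t * \<bar>r i\<bar>" by (intro mult_right_mono) auto
      then show "(r i)\<^sup>2 \<le> t * \<bar>r i\<bar>" by (simp add: power2_eq_square)
    qed
    also have "\<dots> = t * (\<Sum>i\<in>C - B. \<bar>r i\<bar>)" by (simp add: sum_distrib_left)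
    also have "\<dots> \<le> t * a" using sumr a0 by (intro mult_left_mono)
    also have "\<dots> = (a / sqrt m)\<^sup>2" using m by (simp add: t_def power_divide power2_eq_square)
    finally show ?thesis unfolding L2_set_def using a0 by (intro real_le_lsqrt) (auto simp: sum_nonneg)
  qed
  then have rN: "L2_set r C \<le> \<eta> * N" using a by simp
  have "N \<le> L2_set q C + L2_set r C"
    unfolding N_def by (subst wqr) (rule L2_set_triangle_ineq)
  also have "L2_set q C \<le> L2_set q (A \<union> B)"
  proof -
    have "L2_set q C = L2_set q B"
      using fin BC disj by (intro L2_set_mono_neutral[symmetric]) (auto simp: q_def)
    also have "\<dots> \<le> L2_set q (A \<union> B)" using fin BC by (intro L2_set_mono_set) auto
    finally show ?thesis .
  qed
  finally have "(1 - \<eta>) * N \<le> L2_set q (A \<union> B)" using rN by (simp add: algebra_simps)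
  moreover have "1/2 * N \<le> (1 - \<eta>) * N" using eta N0 by (intro mult_right_mono) auto
  ultimately have "l * (1/2 * N) \<le> l * L2_set q (A \<union> B)" using l by (intro mult_left_mono) auto
  also have "\<dots> \<le> f q" using BC cardB by (intro lower) (auto simp: q_def)
  also have "f q \<le> f w + f r"
    using sub_le[of w r] by (simp add: wqr)
  finally have "l * (1/2 * N) \<le> f w + \<Lambda> * (2 * (\<eta> * N))" using fr by simp
  \<comment> \<open>The tail costs at most 2 * \<open>\<Lambda>\<close> * \<open>\<eta>\<close> * N
    <= l/4 * N out of l/2 * N.\<close>
  moreover have "8 * \<Lambda> * \<eta> * N \<le> l * N" using eta N0 by (intro mult_right_mono)
  ultimately show ?thesis unfolding N_def[symmetric] by (simp add: algebra_simps)
qed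

end

section \<open>Counting the net\<close>

lemma sum_geometric_int_le:
  "(\<Sum>z\<in>{- int N..int N}. (1/2::real) ^ nat \<bar>z\<bar>) \<le> 3"
proof -
  have "(\<Sum>z\<in>{- int N..int N}. (1/2::real) ^ nat \<bar>z\<bar>) = 3 - 2 * (1/2) ^ N"
  proof (induction N)
    case (Suc N)
    have "{- int (Suc N)..int (Suc N)} = insert (- int (Suc N)) (insert (int (Suc N)) {- int N..int N})"
      by auto
    then show ?case using Suc by (simp add: nat_add_distrib)
  qed simp
  then show ?thesis by simp
qed

text \<open>All supports \<open>S\<close> together with at most \<open>m\<close> further positions
  are covered by one set, so a single union bound treats every choice of these positions. The number
  of nonzero coordinates inside \<open>S\<close> is unrestricted; only the l1 radius
  \<open>N\<close> limits the values there.\<close>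

definition sparse_net :: "nat \<Rightarrow> nat set \<Rightarrow> nat \<Rightarrow> nat \<Rightarrow> (nat \<Rightarrow> int) set" where
  "sparse_net p S m N = {z. (\<forall>i. i \<notin> {..<p} \<longrightarrow> z i = 0) \<and>
    card {i \<in> {..<p} - S. z i \<noteq> 0} \<le> m \<and> (\<Sum>i<p. \<bar>z i\<bar>) \<le> int N}"

text \<open>Each vector is weighted by \<open>(1/2)\<^bsup>|z|\<^esup>\<close> per coordinate and by an
  additional \<open>1/p\<close> per nonzero coordinate outside \<open>S\<close>. The total weight factorises over the
  coordinates, and every vector of the net has a weight bounded from below.\<close>
lemma card_sparse_net:
  fixes p m N :: nat and S :: "nat set"
  assumes S: "S \<subseteq> {..<p}" and p: "p > 0"
  shows "finite (sparse_net p S m N)"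
    "real (card (sparse_net p S m N)) \<le> real p ^ m * 2 ^ N * 3 ^ card S * exp 2"
proof -
  define Z where "Z = sparse_net p S m N"
  note Z_def = Z_def[unfolded sparse_net_def]
  define g :: "nat \<Rightarrow> int \<Rightarrow> real" where
    "g i z = (1/2) ^ nat \<bar>z\<bar> * (if i \<notin> S \<and> z \<noteq> 0 then 1 / p else 1)" for i z
  \<comment> \<open>Restriction embeds the net into a finite \<open>PiE\<close>, over which the sum
    of products factorises.\<close>
  define R where "R = (\<lambda>z :: nat \<Rightarrow> int. restrict z {..<p})"
  define P where "P = PiE {..<p} (\<lambda>_. {- int N..int N})"
  have inj: "inj_on R Z"
  proof (rule inj_onI, rule ext)
    fix z z' i assume "z \<in> Z" "z' \<in> Z" "R z = R z'"
    then show "z i = z' i"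
      by (cases "i < p") (auto simp: Z_def R_def restrict_def fun_eq_iff split: if_splits)
  qed
  have zbound: "\<bar>z i\<bar> \<le> int N" if "z \<in> Z" "i < p" for z i
  proof -
    have "\<bar>z i\<bar> \<le> (\<Sum>i<p. \<bar>z i\<bar>)" using that by (intro member_le_sum) auto
    then show ?thesis using that by (auto simp: Z_def)
  qed
  have sub: "R ` Z \<subseteq> P"
    using zbound by (fastforce simp: R_def P_def)
  have finP: "finite P" unfolding P_def by (intro finite_PiE) auto
  have "finite Z" using inj sub finP by (meson finite_imageD finite_subset)
  then show "finite (sparse_net p S m N)" by (simp add: Z_def sparse_net_def)
  have g0: "g i z \<ge> 0" for i z by (auto simp: g_def)
  define c :: real where "c = (1/2) ^ N * (1 / p) ^ m"
  have weight: "c \<le> (\<Prod>i<p. g i (R z i))" if "z \<in> Z" for z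
  proof -
    have "(\<Prod>i<p. g i (R z i)) = (\<Prod>i<p. (1/2) ^ nat \<bar>z i\<bar>) * (\<Prod>i<p. if i \<notin> S \<and> z i \<noteq> 0 then 1 / p else 1)"
      by (simp add: g_def R_def prod.distrib)
    also have "(\<Prod>i<p. (1/2::real) ^ nat \<bar>z i\<bar>) = (1/2) ^ (\<Sum>i<p. nat \<bar>z i\<bar>)"
      by (simp add: power_sum)
    also have "(\<Prod>i<p. if i \<notin> S \<and> z i \<noteq> 0 then 1 / p else (1::real)) = (\<Prod>i\<in>{i \<in> {..<p} - S. z i \<noteq> 0}. 1 / p)"
      by (intro prod.mono_neutral_cong_right) auto
    also have "\<dots> = (1 / p) ^ card {i \<in> {..<p} - S. z i \<noteq> 0}" by simp
    finally have eq: "(\<Prod>i<p. g i (R z i)) = (1/2) ^ (\<Sum>i<p. nat \<bar>z i\<bar>) * (1 / p) ^ card {i \<in> {..<p} - S. z i \<noteq> 0}" .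
    have "int (\<Sum>i<p. nat \<bar>z i\<bar>) = (\<Sum>i<p. \<bar>z i\<bar>)" by simp
    also have "\<dots> \<le> int N" using that by (simp add: Z_def)
    finally have "(\<Sum>i<p. nat \<bar>z i\<bar>) \<le> N" by linarith
    then have "(1/2::real) ^ N \<le> (1/2) ^ (\<Sum>i<p. nat \<bar>z i\<bar>)" by (intro power_decreasing) auto
    moreover have "(1 / p :: real) ^ m \<le> (1 / p) ^ card {i \<in> {..<p} - S. z i \<noteq> 0}"
      using that p by (intro power_decreasing) (auto simp: Z_def)
    ultimately show ?thesis unfolding eq c_def by (intro mult_mono) auto
  qed
  have "card Z * c = (\<Sum>z\<in>Z. c)" by simp
  also have "\<dots> \<le> (\<Sum>z\<in>Z. \<Prod>i<p. g i (R z i))" using weight by (intro sum_mono) auto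
  also have "\<dots> = (\<Sum>y\<in>R ` Z. \<Prod>i<p. g i (y i))" using inj by (simp add: sum.reindex)
  also have "\<dots> \<le> (\<Sum>y\<in>P. \<Prod>i<p. g i (y i))"
    using finP sub g0 by (intro sum_mono2) (auto intro: prod_nonneg)
  also have "\<dots> = (\<Prod>i<p. \<Sum>z\<in>{- int N..int N}. g i z)"
    unfolding P_def by (subst prod_sum_PiE) auto
  \<comment> \<open>A coordinate in \<open>S\<close> contributes at most 3. Outside \<open>S\<close>
    the value 0 contributes 1 and all other values together at most 2/p, so the product over these
    coordinates stays below exp 2 for every \<open>p\<close>.\<close>
  also have "\<dots> \<le> (\<Prod>i<p. if i \<in> S then 3 else 1 + 2 / p)"
  proof (intro prod_mono conjI sum_nonneg g0)
    fix i
    show "(\<Sum>z\<in>{- int N..int N}. g i z) \<le> (if i \<in> S then 3 else 1 + 2 / p)"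
    proof (cases "i \<in> S")
      case True
      then show ?thesis using sum_geometric_int_le[of N] by (simp add: g_def)
    next
      case False
      have split: "(\<Sum>z\<in>{- int N..int N}. h z) = h 0 + (\<Sum>z\<in>{- int N..int N} - {0}. h z)" for h :: "int \<Rightarrow> real"
        by (intro sum.remove) auto
      have "(\<Sum>z\<in>{- int N..int N} - {0}. g i z) = (\<Sum>z\<in>{- int N..int N} - {0}. (1/2) ^ nat \<bar>z\<bar>) / p"
        unfolding sum_divide_distrib using False by (intro sum.cong) (auto simp: g_def)
      also have "\<dots> \<le> 2 / p"
        using sum_geometric_int_le[of N] by (intro divide_right_mono) (auto simp: split)
      finally show ?thesis using False by (simp add: split g_def)
    qed
  qed
  also have "\<dots> = (\<Prod>i\<in>S. 3) * (\<Prod>i\<in>{..<p} - S. 1 + 2 / real p)"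
  proof -
    have "{..<p} \<inter> S = S" "{..<p} \<inter> - S = {..<p} - S" using S by auto
    then show ?thesis by (subst prod.If_cases) auto
  qed
  also have "\<dots> \<le> 3 ^ card S * exp 2"
  proof -
    have "(1 + 2 / real p) ^ card ({..<p} - S) \<le> (1 + 2 / real p) ^ p"
      using card_mono[of "{..<p}" "{..<p} - S"] by (intro power_increasing) auto
    also have "\<dots> \<le> exp (2 / real p) ^ p" by (intro power_mono) auto
    also have "\<dots> = exp 2" using p by (simp flip: exp_of_nat_mult)
    finally show ?thesis by (simp add: mult_left_mono)
  qed
  finally have le: "card Z * c \<le> 3 ^ card S * exp 2" .
  have c: "c * (real p ^ m * 2 ^ N) = 1"
    using p by (simp add: c_def power_divide)
  have "real (card Z) = card Z * c * (real p ^ m * 2 ^ N)"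
    unfolding mult.assoc c by simp
  also have "\<dots> \<le> 3 ^ card S * exp 2 * (real p ^ m * 2 ^ N)"
    using le by (rule mult_right_mono) simp
  finally show "real (card (sparse_net p S m N)) \<le> real p ^ m * 2 ^ N * 3 ^ card S * exp 2"
    by (simp add: mult_ac Z_def sparse_net_def)
qed

section \<open>Gaussian tail bounds\<close>

text \<open>The exponentially tilted density is, up to the factor on the right, the centred normal
  density of variance v / (1 - 2 t). Negative \<open>t\<close> is allowed and later yields the lower
  tail.\<close>

lemma nn_integral_exp_square_normal:
  fixes v t :: real
  assumes v: "v > 0" and t: "t < 1/2"
  shows "(\<integral>\<^sup>+x. ennreal (exp (t * x\<^sup>2 / v)) \<partial>centered_normal v) = ennreal (1 / sqrt (1 - 2 * t))"
proof -
  define s where "s = sqrt (v / (1 - 2 * t))"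
  have pos: "1 - 2 * t > 0" "s > 0" using v t by (auto simp: s_def)
  have s2: "s\<^sup>2 = v / (1 - 2 * t)" using v pos by (simp add: s_def)
  have eq: "normal_density 0 (sqrt v) x * exp (t * x\<^sup>2 / v) = 1 / sqrt (1 - 2 * t) * normal_density 0 s x" for x
  proof -
    have "- x\<^sup>2 / (2 * v) + t * x\<^sup>2 / v = - x\<^sup>2 / (2 * s\<^sup>2)"
      using v pos by (simp add: s2 field_simps)
    moreover have "sqrt (2 * pi * v) = sqrt (2 * pi * s\<^sup>2) * sqrt (1 - 2 * t)"
      using v pos by (simp add: s2 real_sqrt_mult[symmetric])
    ultimately show ?thesis
      using v by (simp add: normal_density_def exp_add[symmetric])
  qed
  have "(\<integral>\<^sup>+x. ennreal (exp (t * x\<^sup>2 / v)) \<partial>centered_normal v) =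
      (\<integral>\<^sup>+x. ennreal (normal_density 0 (sqrt v) x) * ennreal (exp (t * x\<^sup>2 / v)) \<partial>lborel)"
    using v by (simp add: centered_normal_def nn_integral_density)
  also have "\<dots> = (\<integral>\<^sup>+x. ennreal (1 / sqrt (1 - 2 * t)) * ennreal (normal_density 0 s x) \<partial>lborel)"
    using pos by (simp add: ennreal_mult'[symmetric] eq)
  also have "\<dots> = ennreal (1 / sqrt (1 - 2 * t)) * (\<integral>\<^sup>+x. ennreal (normal_density 0 s x) \<partial>lborel)"
    by (intro nn_integral_cmult) auto
  also have "(\<integral>\<^sup>+x. ennreal (normal_density 0 s x) \<partial>lborel) = 1"
    using pos by (simp add: nn_integral_eq_integral)
  finally show ?thesis by simp
qed

text \<open>The entries of X w, with \<open>w\<close> a function on \<open>nat\<close> so that the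
  seminorm locale applies and supports can change without changing dimensions. Values of
  \<open>w\<close> from \<open>p\<close> on are ignored.\<close>

definition design_app :: "nat \<Rightarrow> real mat \<Rightarrow> (nat \<Rightarrow> real) \<Rightarrow> nat \<Rightarrow> real" where
  "design_app p X w i = (\<Sum>k<p. X $$ (i, k) * w k)"

definition quad_form :: "nat \<Rightarrow> real mat \<Rightarrow> (nat \<Rightarrow> real) \<Rightarrow> real" where
  "quad_form p C w = scalar_prod (vec p w) (C *\<^sub>v vec p w)"

lemma gaussian_design_entry_measurable:
  assumes "prob_space M" and "gaussian_design M n p C X" "i < n" "k < p"
  shows "(\<lambda>\<omega>. X \<omega> $$ (i, k)) \<in> borel_measurable M"
proof -
  interpret prob_space M by fact
  have "indep_vars (\<lambda>_. PiM {..<p} (\<lambda>_. borel)) (\<lambda>i \<omega>. \<lambda>k\<in>{..<p}. X \<omega> $$ (i, k)) {..<n}"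
    using assms(2) by (simp add: gaussian_design_def)
  then have m: "(\<lambda>\<omega>. \<lambda>k\<in>{..<p}. X \<omega> $$ (i, k)) \<in> measurable M (PiM {..<p} (\<lambda>_. borel))"
    using assms(3) by (auto simp: indep_vars_def)
  have "(\<lambda>\<omega>. (\<lambda>k\<in>{..<p}. X \<omega> $$ (i, k)) k) \<in> borel_measurable M"
    using measurable_compose[OF m measurable_component_singleton[of k "{..<p}" "\<lambda>_. borel"]] assms(4) by simp
  then show ?thesis using assms(4) by simp
qed

text \<open>The entries of X w are independent and centred normal with variance
  \<open>quad_form p C w\<close>, so this is the transform of a chi-square variable with
  \<open>n\<close> degrees of freedom.\<close>

lemma gaussian_design_mgf:
  assumes M: "prob_space M" and G: "gaussian_design M n p C X"
    and v: "quad_form p C w > 0" and t: "t < 1/2"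
  shows "(\<integral>\<^sup>+\<omega>. ennreal (exp (t * (\<Sum>i<n. (design_app p (X \<omega>) w i)\<^sup>2) / quad_form p C w)) \<partial>M)
    = ennreal (1 / sqrt (1 - 2 * t)) ^ n"
proof -
  interpret prob_space M by fact
  define v where "v = quad_form p C w"
  define Y where "Y = (\<lambda>i \<omega>. ennreal (exp (t * (design_app p (X \<omega>) w i)\<^sup>2 / v)))"
  have ind: "indep_vars (\<lambda>_. borel) Y {..<n}"
  proof -
    have "indep_vars (\<lambda>_. PiM {..<p} (\<lambda>_. borel)) (\<lambda>i \<omega>. \<lambda>k\<in>{..<p}. X \<omega> $$ (i, k)) {..<n}"
      using G by (simp add: gaussian_design_def)
    from indep_vars_compose2[OF this, where N="\<lambda>_. borel" and
        Y="\<lambda>_ h. ennreal (exp (t * (\<Sum>k<p. h k * w k)\<^sup>2 / v))"]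
    have "indep_vars (\<lambda>_. borel) (\<lambda>i \<omega>. ennreal (exp (t * (\<Sum>k<p. (\<lambda>k\<in>{..<p}. X \<omega> $$ (i, k)) k * w k)\<^sup>2 / v))) {..<n}"
      by simp
    moreover have "(\<Sum>k<p. (\<lambda>k\<in>{..<p}. X \<omega> $$ (i, k)) k * w k) = design_app p (X \<omega>) w i" for i \<omega>
      by (simp add: design_app_def)
    ultimately show ?thesis by (simp add: Y_def)
  qed
  have one: "(\<integral>\<^sup>+\<omega>. Y i \<omega> \<partial>M) = ennreal (1 / sqrt (1 - 2 * t))" if "i < n" for i
  proof -
    have gv: "gaussian_vec M p C (\<lambda>\<omega>. row (X \<omega>) i)" using G that by (simp add: gaussian_design_def)
    have X: "X \<omega> \<in> carrier_mat n p" if "\<omega> \<in> space M" for \<omega> using G that by (simp add: gaussian_design_def)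
    let ?a = "vec p w"
    have m: "(\<lambda>\<omega>. scalar_prod ?a (row (X \<omega>) i)) \<in> borel_measurable M"
      and d: "distr M borel (\<lambda>\<omega>. scalar_prod ?a (row (X \<omega>) i)) = centered_normal v"
      using gv unfolding gaussian_vec_def v_def quad_form_def by auto
    have eq: "design_app p (X \<omega>) w i = scalar_prod ?a (row (X \<omega>) i)" if "\<omega> \<in> space M" for \<omega>
      using X[OF that] \<open>i < n\<close>
      by (auto simp: design_app_def scalar_prod_def atLeast0LessThan mult.commute intro!: sum.cong)
    have "(\<integral>\<^sup>+\<omega>. Y i \<omega> \<partial>M) =
        (\<integral>\<^sup>+\<omega>. (\<lambda>x. ennreal (exp (t * x\<^sup>2 / v))) (scalar_prod ?a (row (X \<omega>) i)) \<partial>M)"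
      by (intro nn_integral_cong) (simp add: Y_def eq)
    also have "\<dots> = (\<integral>\<^sup>+x. ennreal (exp (t * x\<^sup>2 / v)) \<partial>distr M borel (\<lambda>\<omega>. scalar_prod ?a (row (X \<omega>) i)))"
      using m by (subst nn_integral_distr) auto
    also have "\<dots> = ennreal (1 / sqrt (1 - 2 * t))"
      unfolding d using assms(3) t by (intro nn_integral_exp_square_normal) (auto simp: v_def)
    finally show ?thesis .
  qed
  have "(\<integral>\<^sup>+\<omega>. ennreal (exp (t * (\<Sum>i<n. (design_app p (X \<omega>) w i)\<^sup>2) / v)) \<partial>M)
    = (\<integral>\<^sup>+\<omega>. (\<Prod>i<n. Y i \<omega>) \<partial>M)"
    by (simp add: Y_def prod_ennreal exp_sum[symmetric] sum_distrib_left sum_divide_distrib)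
  also have "\<dots> = (\<Prod>i<n. \<integral>\<^sup>+\<omega>. Y i \<omega> \<partial>M)"
    using ind by (intro indep_vars_nn_integral) (auto simp: Y_def)
  also have "\<dots> = ennreal (1 / sqrt (1 - 2 * t)) ^ n"
    using one by simp
  finally show ?thesis by (simp add: v_def)
qed

text \<open>Markov's inequality for the exponential of t Q / v. Since \<open>t\<close> carries a
  sign, one statement covers both tails.\<close>

lemma gaussian_design_chernoff:
  fixes b :: real
  assumes M: "prob_space M" and G: "gaussian_design M n p C X"
    and v: "quad_form p C w > 0" and t: "t < 1/2"
  defines "E \<equiv> {\<omega> \<in> space M. b * quad_form p C w \<le> t * (\<Sum>i<n. (design_app p (X \<omega>) w i)\<^sup>2)}"
  shows "E \<in> sets M" "measure M E \<le> exp (- b) * (1 / sqrt (1 - 2 * t)) ^ n"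
proof -
  interpret prob_space M by fact
  define v where "v = quad_form p C w"
  define Q where "Q = (\<lambda>\<omega>. \<Sum>i<n. (design_app p (X \<omega>) w i)\<^sup>2)"
  have m: "(\<lambda>\<omega>. design_app p (X \<omega>) w i) \<in> borel_measurable M" if "i < n" for i
    unfolding design_app_def using gaussian_design_entry_measurable[OF M G] that
    by (intro borel_measurable_sum borel_measurable_times) auto
  have [measurable]: "Q \<in> borel_measurable M"
    unfolding Q_def by (intro borel_measurable_sum borel_measurable_power m) simp
  have "E = {\<omega> \<in> space M. b * v \<le> t * Q \<omega>}" by (simp add: E_def Q_def v_def)
  then show "E \<in> sets M" by simp
  define u where "u = (\<lambda>\<omega>. ennreal (exp (t * Q \<omega> / v)))"
  have [measurable]: "u \<in> borel_measurable M" unfolding u_def by measurable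
  have "E = {\<omega> \<in> space M. 1 \<le> ennreal (exp (- b)) * u \<omega>}"
  proof -
    have "b * v \<le> t * Q \<omega> \<longleftrightarrow> 1 \<le> ennreal (exp (- b)) * u \<omega>" for \<omega>
    proof -
      have "ennreal (exp (- b)) * u \<omega> = ennreal (exp (- b + t * Q \<omega> / v))"
        by (simp add: u_def ennreal_mult'[symmetric] exp_add[symmetric])
      moreover have "1 \<le> ennreal (exp x) \<longleftrightarrow> 0 \<le> x" for x
        using ennreal_le_iff[of "exp x" 1] by simp
      moreover have "b * v \<le> t * Q \<omega> \<longleftrightarrow> 0 \<le> - b + t * Q \<omega> / v"
        using v by (simp add: v_def field_simps)
      ultimately show ?thesis by simp
    qed
    then show ?thesis by (simp add: E_def Q_def v_def)
  qed
  then have "emeasure M E \<le> ennreal (exp (- b)) * (\<integral>\<^sup>+\<omega>. u \<omega> * indicator (space M) \<omega> \<partial>M)"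
    using nn_integral_Markov_inequality[of u "space M" M "ennreal (exp (- b))"] by simp
  also have "(\<integral>\<^sup>+\<omega>. u \<omega> * indicator (space M) \<omega> \<partial>M) = (\<integral>\<^sup>+\<omega>. u \<omega> \<partial>M)"
    by (intro nn_integral_cong) auto
  also have "\<dots> = ennreal (1 / sqrt (1 - 2 * t)) ^ n"
    using gaussian_design_mgf[OF M G v t] by (simp add: u_def Q_def v_def)
  also have "ennreal (exp (- b)) * ennreal (1 / sqrt (1 - 2 * t)) ^ n
      = ennreal (exp (- b) * (1 / sqrt (1 - 2 * t)) ^ n)"
    using t by (simp add: ennreal_power ennreal_mult')
  finally show "measure M E \<le> exp (- b) * (1 / sqrt (1 - 2 * t)) ^ n"
    using t by (simp add: emeasure_eq_measure)
qed

text \<open>The constants are chosen to make the Chernoff bounds explicit. For the upper tail, t =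
  1/4 and b = n give exp(-n) * 2^(n/2), and 2 <= e. For the lower tail, t = -4 and b = -n/2 give
  exp(n/2) * 3^(-n), and e <= 3.\<close>

lemma gaussian_design_concentration:
  assumes M: "prob_space M" and G: "gaussian_design M n p C X" and v: "quad_form p C w > 0"
  defines "Q \<equiv> \<lambda>\<omega>. \<Sum>i<n. (design_app p (X \<omega>) w i)\<^sup>2"
  defines "E \<equiv> {\<omega> \<in> space M. Q \<omega> \<le> n * quad_form p C w / 8 \<or> 4 * n * quad_form p C w \<le> Q \<omega>}"
  shows "E \<in> sets M" "measure M E \<le> 2 * exp (- real n / 2)"
proof -
  interpret prob_space M by fact
  define A where "A = {\<omega> \<in> space M. n * quad_form p C w \<le> 1/4 * Q \<omega>}"
  define B where "B = {\<omega> \<in> space M. (- (n / 2)) * quad_form p C w \<le> (- 4) * Q \<omega>}"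
  have A: "A \<in> sets M" "measure M A \<le> exp (- real n) * (1 / sqrt (1 - 2 * (1/4))) ^ n"
    unfolding A_def Q_def by (rule gaussian_design_chernoff[OF M G v]; simp)+
  have B: "B \<in> sets M" "measure M B \<le> exp (- (- (n / 2))) * (1 / sqrt (1 - 2 * (- 4))) ^ n"
    unfolding B_def Q_def by (rule gaussian_design_chernoff[OF M G v]; simp)+
  have E: "E = A \<union> B" by (auto simp: E_def A_def B_def field_simps)
  show "E \<in> sets M" unfolding E using A B by auto
  have "exp (- real n) * (1 / sqrt (1 - 2 * (1/4))) ^ n \<le> exp (- real n) * exp (1/2) ^ n"
  proof -
    have "(2::real) \<le> exp 1" using exp_ge_add_one_self[of 1] by simp
    then have "sqrt 2 \<le> sqrt (exp 1)" by simp
    also have "sqrt (exp 1) = exp (1/2)"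
      by (rule real_sqrt_unique) (auto simp: power2_eq_square exp_add[symmetric])
    finally have "1 / sqrt (1 - 2 * (1/4)) \<le> exp (1/2)" by (simp add: real_sqrt_divide)
    then show ?thesis by (intro mult_left_mono power_mono) auto
  qed
  also have "\<dots> = exp (- real n / 2)" by (simp flip: exp_of_nat_mult exp_add)
  finally have A': "measure M A \<le> exp (- real n / 2)" using A by simp
  have "exp (- (- (n / 2))) * (1 / sqrt (1 - 2 * (- 4))) ^ n \<le> exp (n / 2) * exp (- 1) ^ n"
  proof -
    have "1 / sqrt (1 - 2 * (- 4)) = (1/3 :: real)"
      using real_sqrt_unique[of 3 9] by simp
    also have "\<dots> \<le> exp (- 1)"
      using exp_le by (simp add: exp_minus field_simps)
    finally show ?thesis unfolding minus_minus by (intro mult_left_mono power_mono) auto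
  qed
  also have "\<dots> = exp (- real n / 2)" by (simp flip: exp_of_nat_mult exp_add)
  finally have B': "measure M B \<le> exp (- real n / 2)" using B by simp
  have "measure M E \<le> measure M A + measure M B"
    unfolding E using A B by (intro measure_Un_le) auto
  then show "measure M E \<le> 2 * exp (- real n / 2)" using A' B' by simp
qed

section \<open>Eigenvalues and quadratic forms\<close>

text \<open>Tychonoff's theorem. A singleton \<open>K i\<close> pins an irrelevant coordinate, so
  finite-dimensional compactness is available inside a function space.\<close>

lemma compact_real_box:
  fixes K :: "'i \<Rightarrow> real set"
  assumes "\<And>i. compact (K i)"
  shows "compact {f. \<forall>i. f i \<in> K i}"
proof -
  have "compactin (product_topology (\<lambda>_. euclidean) UNIV) (PiE UNIV K)"
    unfolding compactin_PiE using assms by simp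
  then show ?thesis
    unfolding euclidean_product_topology by (simp add: PiE_def Pi_def)
qed

text \<open>The witness is the maximum of the Rayleigh quotient, attained by compactness of the sphere.\<close>
lemma symmetric_ex_max_eigenvalue:
  fixes A :: "real mat"
  assumes A: "A \<in> carrier_mat p p" and sym: "transpose_mat A = A" and p: "p > 0"
  shows "\<exists>e. eigenvalue A e \<and>
    (\<forall>w\<in>carrier_vec p. scalar_prod w (A *\<^sub>v w) \<le> e * scalar_prod w w)"
proof -
  define Q where "Q = (\<lambda>f :: nat \<Rightarrow> real. \<Sum>i<p. f i * (\<Sum>k<p. A $$ (i, k) * f k))"
  \<comment> \<open>The sphere already forces the entries into [-1, 1]; the box is stated because it
    makes compactness immediate.\<close>
  define D where "D = {f :: nat \<Rightarrow> real. \<forall>i. f i \<in> (if i < p then {-1..1} else {0})} \<inter> {f. (\<Sum>i<p. (f i)\<^sup>2) = 1}"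
  have "compact D"
    unfolding D_def
    by (intro compact_Int_closed compact_real_box closed_Collect_eq continuous_intros
        continuous_on_product_coordinates) auto
  moreover have "D \<noteq> {}"
  proof -
    have "(\<lambda>i. if i = 0 then 1 else 0) \<in> D"
      using p by (auto simp: D_def if_distrib[of "\<lambda>x. x\<^sup>2"] cong: if_cong)
    then show ?thesis by auto
  qed
  moreover have "continuous_on D Q"
    unfolding Q_def
    by (intro continuous_intros continuous_on_subset[OF continuous_on_product_coordinates]) auto
  ultimately obtain f where f: "f \<in> D" "\<And>g. g \<in> D \<Longrightarrow> Q g \<le> Q f"
    using continuous_attains_sup[of D Q] by blast
  define v where "v = vec p f"
  define e where "e = Q f"
  have Qvec: "scalar_prod (vec p g) (A *\<^sub>v vec p g) = Q g" for g
    using A by (auto simp: Q_def scalar_prod_def atLeast0LessThan intro!: sum.cong)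
  have v: "v \<in> carrier_vec p" "scalar_prod v v = 1"
    using f(1) by (auto simp: v_def D_def scalar_prod_def atLeast0LessThan power2_eq_square)
  have max: "scalar_prod w (A *\<^sub>v w) \<le> e * scalar_prod w w" if w: "w \<in> carrier_vec p" for w
  proof (cases "scalar_prod w w = 0")
    case True
    have "scalar_prod w w = (\<Sum>i<p. (w $ i)\<^sup>2)"
      using w by (auto simp: scalar_prod_def atLeast0LessThan power2_eq_square)
    then have "\<forall>i<p. w $ i = 0" using True by (simp add: sum_nonneg_eq_0_iff)
    then have "scalar_prod w (A *\<^sub>v w) = 0"
      using w A by (auto simp: scalar_prod_def)
    then show ?thesis using True by simp
  next
    case False
    have ww: "scalar_prod w w = (\<Sum>i<p. (w $ i)\<^sup>2)"
      using w by (auto simp: scalar_prod_def atLeast0LessThan power2_eq_square)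
    then have pos: "scalar_prod w w > 0" using False by (simp add: order_less_le sum_nonneg)
    define s where "s = sqrt (scalar_prod w w)"
    have s: "s > 0" "s\<^sup>2 = scalar_prod w w" using pos by (auto simp: s_def)
    define g where "g = (\<lambda>i. if i < p then w $ i / s else 0)"
    have g1: "(\<Sum>i<p. (g i)\<^sup>2) = 1"
      using s ww False by (simp add: g_def power_divide flip: sum_divide_distrib)
    have le1: "\<bar>g i\<bar> \<le> 1" if "i < p" for i
    proof -
      have "(g i)\<^sup>2 \<le> (\<Sum>i<p. (g i)\<^sup>2)" using that by (intro member_le_sum) auto
      then show ?thesis using g1 by (simp add: abs_square_le_1)
    qed
    have "g i \<in> (if i < p then {-1..1} else {0})" for i
    proof (cases "i < p")
      case True
      then show ?thesis using le1[of i] by auto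
    qed (simp add: g_def)
    then have "g \<in> D" using g1 by (simp add: D_def)
    then have "Q g \<le> e" unfolding e_def by (rule f(2))
    moreover have "Q g = scalar_prod w (A *\<^sub>v w) / s\<^sup>2"
    proof -
      have "w = vec p (\<lambda>i. w $ i)" using w by auto
      then have "scalar_prod w (A *\<^sub>v w) = Q (\<lambda>i. w $ i)" using Qvec[of "\<lambda>i. w $ i"] by simp
      also have "Q g = Q (\<lambda>i. w $ i) / s\<^sup>2"
        by (simp add: Q_def g_def sum_divide_distrib sum_distrib_left power2_eq_square)
      finally show ?thesis by simp
    qed
    ultimately show ?thesis using s pos by (simp add: field_simps)
  qed
  \<comment> \<open>First-order optimality: \<open>g\<close> is the defect of the eigenvalue
    equation. Comparing the Rayleigh quotient at v + t g with its maximum at \<open>v\<close> gives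
    2 |g|^2 + t F <= 0 for all t > 0, so g = 0.\<close>
  define g where "g = A *\<^sub>v v - e \<cdot>\<^sub>v v"
  have Av: "A *\<^sub>v v \<in> carrier_vec p" using A v by auto
  have g: "g \<in> carrier_vec p" and Ag: "A *\<^sub>v g \<in> carrier_vec p" using A Av v by (auto simp: g_def)
  have gg: "scalar_prod g g = scalar_prod g (A *\<^sub>v v) - e * scalar_prod g v"
    using g Av v unfolding g_def[symmetric]
    by (subst (2) g_def) (simp add: scalar_prod_minus_distrib[of _ p])
  have vAg: "scalar_prod v (A *\<^sub>v g) = scalar_prod g (A *\<^sub>v v)"
    using transpose_vec_mult_scalar[OF A g v(1)] sym comm_scalar_prod[OF _ g, of "A *\<^sub>v v"] Av
    by simp
  define F where "F = scalar_prod g (A *\<^sub>v g) - e * scalar_prod g g"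
  have ineq: "2 * scalar_prod g g + t * F \<le> 0" if t: "t > 0" for t
  proof -
    let ?w = "v + t \<cdot>\<^sub>v g"
    have "A *\<^sub>v ?w = A *\<^sub>v v + t \<cdot>\<^sub>v (A *\<^sub>v g)"
      using A v g by (simp add: mult_add_distrib_mat_vec[of _ p p] mult_mat_vec[of _ p p])
    then have a1: "scalar_prod ?w (A *\<^sub>v ?w) =
        e + 2 * t * scalar_prod g (A *\<^sub>v v) + t\<^sup>2 * scalar_prod g (A *\<^sub>v g)"
      using v g Av Ag Qvec[of f] vAg
      by (simp add: scalar_prod_add_distrib[of _ p] add_scalar_prod_distrib[of _ p] e_def v_def[symmetric]
          power2_eq_square algebra_simps)
    have a2: "scalar_prod ?w ?w = 1 + 2 * t * scalar_prod g v + t\<^sup>2 * scalar_prod g g"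
      using v g comm_scalar_prod[OF g v(1)]
      by (simp add: scalar_prod_add_distrib[of _ p] add_scalar_prod_distrib[of _ p]
          power2_eq_square algebra_simps)
    have a3: "scalar_prod ?w (A *\<^sub>v ?w) \<le> e * scalar_prod ?w ?w"
      using v g by (intro max) auto
    have a4: "scalar_prod g (A *\<^sub>v v) = scalar_prod g g + e * scalar_prod g v"
      using gg by simp
    have "t * (2 * scalar_prod g g + t * F) \<le> 0"
      using a3 unfolding a1 a2 a4 F_def by (simp add: algebra_simps power2_eq_square)
    then show ?thesis using t by (simp add: mult_le_0_iff)
  qed
  have "scalar_prod g g \<le> 0"
  proof (rule ccontr)
    assume "\<not> ?thesis"
    then have pos: "scalar_prod g g > 0" by simp
    \<comment> \<open>Small enough for |t F| <= |g|^2; the 1 guards against F = 0.\<close>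
    define t where "t = scalar_prod g g / (\<bar>F\<bar> + 1)"
    have t: "t > 0" using pos by (simp add: t_def)
    have "- (t * F) \<le> t * \<bar>F\<bar>" using t by (simp add: abs_if)
    also have "\<dots> \<le> t * (\<bar>F\<bar> + 1)" using t by simp
    also have "\<dots> = scalar_prod g g" by (simp add: t_def)
    finally show False using ineq[OF t] pos by linarith
  qed
  moreover have "scalar_prod g g = (\<Sum>i<p. (g $ i)\<^sup>2)"
    using g by (auto simp: scalar_prod_def atLeast0LessThan power2_eq_square)
  ultimately have "(\<Sum>i<p. (g $ i)\<^sup>2) = 0" by (simp add: order_antisym sum_nonneg)
  then have g0: "g $ i = 0" if "i < p" for i using that by (simp add: sum_nonneg_eq_0_iff)
  have "A *\<^sub>v v = e \<cdot>\<^sub>v v"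
  proof
    show "dim_vec (A *\<^sub>v v) = dim_vec (e \<cdot>\<^sub>v v)" using A v by simp
    show "(A *\<^sub>v v) $ i = (e \<cdot>\<^sub>v v) $ i" if "i < dim_vec (e \<cdot>\<^sub>v v)" for i
      using g0[of i] that v A by (simp add: g_def)
  qed
  moreover have "v \<noteq> 0\<^sub>v p" using v by auto
  ultimately have "eigenvalue A e"
    using A v unfolding eigenvalue_def eigenvector_def by auto
  then show ?thesis using max by blast
qed

text \<open>Eigenvalues of \<open>\<Sigma>\<close> are reciprocals of eigenvalues of
  \<open>\<Phi>\<close>, and [1/L, L] is invariant under reciprocals. The largest eigenvalue of
  \<open>\<Sigma>\<close> gives the upper bound and that of \<open>- \<Sigma>\<close> the lower
  one.\<close>

lemma quad_form_bounds_of_inverse_eigenvalues: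
  fixes \<Sigma> \<Phi> :: "real mat"
  assumes \<Sigma>: "\<Sigma> \<in> carrier_mat p p" "transpose_mat \<Sigma> = \<Sigma>"
    and \<Phi>: "\<Phi> \<in> carrier_mat p p" "inverts_mat \<Phi> \<Sigma>"
    and L: "L \<ge> 1" and eigen: "\<And>e. eigenvalue \<Phi> e \<Longrightarrow> e \<in> {1 / L..L}" and p: "p > 0"
    and w: "w \<in> carrier_vec p"
  shows "1 / L * scalar_prod w w \<le> scalar_prod w (\<Sigma> *\<^sub>v w)"
    "scalar_prod w (\<Sigma> *\<^sub>v w) \<le> L * scalar_prod w w"
proof -
  have ww: "scalar_prod w w \<ge> 0" using w by (auto simp: scalar_prod_def intro: sum_nonneg)
  have ev: "\<mu> \<in> {1 / L..L}" if v: "v \<in> carrier_vec p" "v \<noteq> 0\<^sub>v p" "\<Sigma> *\<^sub>v v = \<mu> \<cdot>\<^sub>v v" for \<mu> v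
  proof -
    have "v = (\<Phi> * \<Sigma>) *\<^sub>v v" using \<Phi> v by (simp add: inverts_mat_def)
    also have "\<dots> = \<mu> \<cdot>\<^sub>v (\<Phi> *\<^sub>v v)"
      using \<Phi> \<Sigma> v by (simp add: assoc_mult_mat_vec[of _ p p] mult_mat_vec[of _ p p])
    finally have eq: "v = \<mu> \<cdot>\<^sub>v (\<Phi> *\<^sub>v v)" .
    have \<mu>: "\<mu> \<noteq> 0"
    proof
      assume "\<mu> = 0"
      then have "\<mu> \<cdot>\<^sub>v (\<Phi> *\<^sub>v v) = 0\<^sub>v p" using \<Phi> by (intro eq_vecI) auto
      then show False using v eq by simp
    qed
    have "\<Phi> *\<^sub>v v = (1 / \<mu>) \<cdot>\<^sub>v v"
      using \<mu> by (subst (2) eq) (simp add: smult_smult_assoc)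
    then have "eigenvalue \<Phi> (1 / \<mu>)"
      using \<Phi> v unfolding eigenvalue_def eigenvector_def by auto
    from eigen[OF this] have b: "1 / L \<le> 1 / \<mu>" "1 / \<mu> \<le> L" by auto
    have "0 < 1 / L" using L by simp
    then have "\<mu> > 0" using b(1) by (meson order_less_le_trans zero_less_divide_1_iff)
    then show ?thesis using b L by (auto simp: field_simps)
  qed
  obtain e where e: "eigenvalue \<Sigma> e" "scalar_prod w (\<Sigma> *\<^sub>v w) \<le> e * scalar_prod w w"
    using symmetric_ex_max_eigenvalue[OF \<Sigma> p] w by blast
  then have "e \<in> {1 / L..L}" using ev \<Sigma> unfolding eigenvalue_def eigenvector_def by auto
  then show "scalar_prod w (\<Sigma> *\<^sub>v w) \<le> L * scalar_prod w w"
    using e(2) ww by (meson atLeastAtMost_iff mult_right_mono order_trans)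
  have neg: "- \<Sigma> \<in> carrier_mat p p" "transpose_mat (- \<Sigma>) = - \<Sigma>"
    using \<Sigma> by (auto simp: transpose_uminus)
  have negmult: "(- \<Sigma>) *\<^sub>v u = - (\<Sigma> *\<^sub>v u)" if "u \<in> carrier_vec p" for u
    using \<Sigma> that by (intro eq_vecI) (auto simp: scalar_prod_def sum_negf)
  obtain e where e: "eigenvalue (- \<Sigma>) e" "scalar_prod w ((- \<Sigma>) *\<^sub>v w) \<le> e * scalar_prod w w"
    using symmetric_ex_max_eigenvalue[OF neg p] w by blast
  then obtain v where v: "v \<in> carrier_vec p" "v \<noteq> 0\<^sub>v p" "(- \<Sigma>) *\<^sub>v v = e \<cdot>\<^sub>v v"
    using \<Sigma> unfolding eigenvalue_def eigenvector_def by auto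
  have "\<Sigma> *\<^sub>v v = (- e) \<cdot>\<^sub>v v"
  proof -
    have "\<Sigma> *\<^sub>v v = - (- (\<Sigma> *\<^sub>v v))" by simp
    also have "\<dots> = - (e \<cdot>\<^sub>v v)" using v negmult[of v] by simp
    also have "\<dots> = (- e) \<cdot>\<^sub>v v" by auto
    finally show ?thesis .
  qed
  from ev[OF v(1,2) this] have "1 / L * scalar_prod w w \<le> - e * scalar_prod w w"
    using ww by (intro mult_right_mono) auto
  moreover have "scalar_prod w ((- \<Sigma>) *\<^sub>v w) = - scalar_prod w (\<Sigma> *\<^sub>v w)"
    using w \<Sigma> by (simp add: negmult scalar_prod_def sum_negf)
  ultimately show "1 / L * scalar_prod w w \<le> scalar_prod w (\<Sigma> *\<^sub>v w)" using e(2) by simp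
qed

section \<open>Measurability of the event\<close>

definition measurable_mat :: "'a measure \<Rightarrow> nat \<Rightarrow> nat \<Rightarrow> ('a \<Rightarrow> real mat) \<Rightarrow> bool" where
  "measurable_mat M r c A \<longleftrightarrow> (\<forall>\<omega>\<in>space M. A \<omega> \<in> carrier_mat r c) \<and>
     (\<forall>i<r. \<forall>k<c. (\<lambda>\<omega>. A \<omega> $$ (i, k)) \<in> borel_measurable M)"

lemma measurable_matI:
  assumes "\<And>\<omega>. \<omega> \<in> space M \<Longrightarrow> A \<omega> \<in> carrier_mat r c"
    and "\<And>i k. i < r \<Longrightarrow> k < c \<Longrightarrow> f i k \<in> borel_measurable M"
    and "\<And>i k \<omega>. i < r \<Longrightarrow> k < c \<Longrightarrow> \<omega> \<in> space M \<Longrightarrow> A \<omega> $$ (i, k) = f i k \<omega>"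
  shows "measurable_mat M r c A"
  unfolding measurable_mat_def
proof (intro conjI ballI allI impI)
  fix i k assume "i < r" "k < c"
  then have "(\<lambda>\<omega>. A \<omega> $$ (i, k)) \<in> borel_measurable M \<longleftrightarrow> f i k \<in> borel_measurable M"
    using assms(3) by (intro measurable_cong) auto
  then show "(\<lambda>\<omega>. A \<omega> $$ (i, k)) \<in> borel_measurable M" using assms(2) \<open>i < r\<close> \<open>k < c\<close> by simp
qed (use assms(1) in auto)

lemma measurable_matD:
  assumes "measurable_mat M r c A"
  shows "\<omega> \<in> space M \<Longrightarrow> A \<omega> \<in> carrier_mat r c"
    "i < r \<Longrightarrow> k < c \<Longrightarrow> (\<lambda>\<omega>. A \<omega> $$ (i, k)) \<in> borel_measurable M"
  using assms by (simp_all add: measurable_mat_def)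

lemma measurable_mat_mult:
  assumes A: "measurable_mat M r m A" and B: "measurable_mat M m c B"
  shows "measurable_mat M r c (\<lambda>\<omega>. A \<omega> * B \<omega>)"
proof (rule measurable_matI)
  show "A \<omega> * B \<omega> \<in> carrier_mat r c" if "\<omega> \<in> space M" for \<omega>
    using measurable_matD(1)[OF A that] measurable_matD(1)[OF B that] by auto
  show "(\<lambda>\<omega>. \<Sum>l<m. A \<omega> $$ (i, l) * B \<omega> $$ (l, k)) \<in> borel_measurable M" if "i < r" "k < c" for i k
    using that by (intro borel_measurable_sum borel_measurable_times measurable_matD(2)[OF A] measurable_matD(2)[OF B]) auto
  show "(A \<omega> * B \<omega>) $$ (i, k) = (\<Sum>l<m. A \<omega> $$ (i, l) * B \<omega> $$ (l, k))"
    if "i < r" "k < c" "\<omega> \<in> space M" for i k \<omega>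
    using measurable_matD(1)[OF A that(3)] measurable_matD(1)[OF B that(3)] that
    by (auto simp: scalar_prod_def atLeast0LessThan)
qed

lemma measurable_mat_transpose:
  assumes A: "measurable_mat M r c A"
  shows "measurable_mat M c r (\<lambda>\<omega>. transpose_mat (A \<omega>))"
proof (rule measurable_matI)
  show "transpose_mat (A \<omega>) \<in> carrier_mat c r" if "\<omega> \<in> space M" for \<omega>
    using measurable_matD(1)[OF A that] by simp
  show "(\<lambda>\<omega>. A \<omega> $$ (k, i)) \<in> borel_measurable M" if "i < c" "k < r" for i k
    using measurable_matD(2)[OF A] that by simp
  show "transpose_mat (A \<omega>) $$ (i, k) = A \<omega> $$ (k, i)" if "i < c" "k < r" "\<omega> \<in> space M" for i k \<omega>
    using measurable_matD(1)[OF A that(3)] that by auto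
qed

lemma measurable_mat_submatrix:
  assumes A: "measurable_mat M r c A"
  shows "measurable_mat M r (card {k. k < c \<and> k \<in> J}) (\<lambda>\<omega>. submatrix (A \<omega>) UNIV J)"
proof (rule measurable_matI)
  show "submatrix (A \<omega>) UNIV J \<in> carrier_mat r (card {k. k < c \<and> k \<in> J})" if "\<omega> \<in> space M" for \<omega>
    using measurable_matD(1)[OF A that] by (auto simp: dim_submatrix intro!: carrier_matI)
  show "(\<lambda>\<omega>. A \<omega> $$ (i, pick J k)) \<in> borel_measurable M" if "i < r" "k < card {k. k < c \<and> k \<in> J}" for i k
    using measurable_matD(2)[OF A] pick_le that by blast
  show "submatrix (A \<omega>) UNIV J $$ (i, k) = A \<omega> $$ (i, pick J k)"
    if "i < r" "k < card {k. k < c \<and> k \<in> J}" "\<omega> \<in> space M" for i k \<omega>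
    using measurable_matD(1)[OF A that(3)] that by (subst submatrix_index) (auto simp: pick_UNIV)
qed

lemma measurable_mat_det:
  assumes A: "measurable_mat M r r A"
  shows "(\<lambda>\<omega>. det (A \<omega>)) \<in> borel_measurable M"
proof -
  have "(\<lambda>\<omega>. \<Sum>\<pi> | \<pi> permutes {0..<r}. signof \<pi> * (\<Prod>i = 0..<r. A \<omega> $$ (i, \<pi> i))) \<in> borel_measurable M"
    by (intro borel_measurable_sum borel_measurable_times borel_measurable_prod borel_measurable_const
        measurable_matD(2)[OF A]) (auto dest: permutes_in_image)
  also have "?this \<longleftrightarrow> ?thesis"
    by (intro measurable_cong) (simp add: det_def'[OF measurable_matD(1)[OF A]])
  finally show ?thesis .
qed

lemma mat_inv_carrier: "A \<in> carrier_mat r r \<Longrightarrow> mat_inv A \<in> carrier_mat r r"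
  unfolding mat_inv_def using mat_inverse(2)[of A r] by (auto split: option.split)

text \<open>Cramer's rule replaces the elimination algorithm behind \<open>mat_inverse\<close>, with
  its pivoting, by a quotient of polynomials in the entries and a single case distinction.
  Measurability of the inverse rests on this.\<close>

lemma mat_inv_index:
  fixes A :: "real mat"
  assumes A: "A \<in> carrier_mat r r" and ik: "i < r" "k < r"
  shows "mat_inv A $$ (i, k) = (if det A = 0 then 0 else adj_mat A $$ (i, k) / det A)"
proof (cases "mat_inverse A")
  case None
  then have "det A = 0"
    using mat_inverse(1)[OF A None, of "()"] det_non_zero_imp_unit[OF A, of "()"] by blast
  then show ?thesis using None A ik by (simp add: mat_inv_def)
next
  case (Some B)
  then have B: "A * B = 1\<^sub>m r" "B \<in> carrier_mat r r" using mat_inverse(2)[OF A Some] by auto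
  have "det A * det B = 1" using det_mult[OF A B(2)] B(1) by simp
  then have nz: "det A \<noteq> 0" by auto
  note adj = adj_mat[OF A]
  have "adj_mat A = adj_mat A * (A * B)" using adj(1) B by simp
  also have "\<dots> = det A \<cdot>\<^sub>m 1\<^sub>m r * B" using adj A B(2) by (simp add: assoc_mult_mat[of _ r r _ r _ r, symmetric])
  also have "\<dots> = det A \<cdot>\<^sub>m B" using B(2) by (simp add: mult_smult_assoc_mat[of _ r r _ r])
  finally have "adj_mat A $$ (i, k) = det A * B $$ (i, k)" using B(2) ik by simp
  then show ?thesis using Some nz by (simp add: mat_inv_def)
qed

lemma measurable_mat_inv:
  assumes A: "measurable_mat M r r A"
  shows "measurable_mat M r r (\<lambda>\<omega>. mat_inv (A \<omega>))"
proof -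
  \<comment> \<open>The adjugate is the transposed cofactor matrix, hence row \<open>k\<close> and
    column \<open>i\<close> are deleted.\<close>
  define c where "c = (\<lambda>i k \<omega>. (-1) ^ (k + i) * det (mat_delete (A \<omega>) k i))"
  have m: "(\<lambda>\<omega>. if det (A \<omega>) = 0 then 0 else c i k \<omega> / det (A \<omega>)) \<in> borel_measurable M"
    if ik: "i < r" "k < r" for i k
  proof -
    have "measurable_mat M (r - 1) (r - 1) (\<lambda>\<omega>. mat_delete (A \<omega>) k i)"
    proof (rule measurable_matI[where f="\<lambda>i' k' \<omega>. A \<omega> $$ (if i' < k then i' else Suc i', if k' < i then k' else Suc k')"])
      show "mat_delete (A \<omega>) k i \<in> carrier_mat (r - 1) (r - 1)" if "\<omega> \<in> space M" for \<omega>
        using mat_delete_carrier[OF measurable_matD(1)[OF A that]] .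
      show "(\<lambda>\<omega>. A \<omega> $$ (if i' < k then i' else Suc i', if k' < i then k' else Suc k')) \<in> borel_measurable M"
        if "i' < r - 1" "k' < r - 1" for i' k'
        using that by (intro measurable_matD(2)[OF A]) auto
      show "mat_delete (A \<omega>) k i $$ (i', k') =
          A \<omega> $$ (if i' < k then i' else Suc i', if k' < i then k' else Suc k')"
        if "i' < r - 1" "k' < r - 1" "\<omega> \<in> space M" for i' k' \<omega>
        using that measurable_matD(1)[OF A that(3)] by (simp add: mat_delete_def)
    qed
    then have d1: "(\<lambda>\<omega>. det (mat_delete (A \<omega>) k i)) \<in> borel_measurable M"
      by (rule measurable_mat_det)
    have d2: "(\<lambda>\<omega>. det (A \<omega>)) \<in> borel_measurable M"
      using A by (rule measurable_mat_det)
    have "c i k \<in> borel_measurable M"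
      unfolding c_def using d1 by (intro borel_measurable_times borel_measurable_const)
    then have "(\<lambda>\<omega>. if det (A \<omega>) = 0 then 0 else c i k \<omega> / det (A \<omega>)) \<in> borel_measurable M"
      using d2 by measurable
    then show ?thesis .
  qed
  have eq: "mat_inv (A \<omega>) $$ (i, k) = (if det (A \<omega>) = 0 then 0 else c i k \<omega> / det (A \<omega>))"
    if "i < r" "k < r" "\<omega> \<in> space M" for i k \<omega>
    using mat_inv_index[OF measurable_matD(1)[OF A that(3)] that(1,2)] measurable_matD(1)[OF A that(3)] that
    by (simp add: adj_mat_def cofactor_def c_def)
  show ?thesis
    by (rule measurable_matI[OF mat_inv_carrier[OF measurable_matD(1)[OF A]] m eq])
qed

lemma measurable_mat_proj:
  assumes X: "measurable_mat M n p X"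
  shows "measurable_mat M n n (\<lambda>\<omega>. proj_mat (X \<omega>) A)"
proof -
  note XA = measurable_mat_submatrix[OF X, of A]
  note XAt = measurable_mat_transpose[OF XA]
  show ?thesis
    unfolding proj_mat_def Let_def
    by (rule measurable_mat_mult[OF measurable_mat_mult[OF XA measurable_mat_inv[OF measurable_mat_mult[OF XAt XA]]] XAt])
qed

lemma resid_inner_measurable:
  assumes X: "measurable_mat M n p X" and kl: "k < p" "l < p"
  shows "(\<lambda>\<omega>. scalar_prod (resid (X \<omega>) S j k) (resid (X \<omega>) S j l)) \<in> borel_measurable M"
proof -
  note P = measurable_mat_proj[OF X, of "S - {j}"]
  define h where "h = (\<lambda>k i \<omega>. \<Sum>q<n. ((if i = q then 1 else 0) - proj_mat (X \<omega>) (S - {j}) $$ (i, q)) * X \<omega> $$ (q, k))"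
  have h: "h k i \<in> borel_measurable M" if "k < p" "i < n" for k i
    unfolding h_def using that
    by (intro borel_measurable_sum borel_measurable_times borel_measurable_diff borel_measurable_const
        measurable_matD(2)[OF P] measurable_matD(2)[OF X]) auto
  have eq: "resid (X \<omega>) S j k = vec n (\<lambda>i. h k i \<omega>)" if "\<omega> \<in> space M" "k < p" for k \<omega>
    using measurable_matD(1)[OF P that(1)] measurable_matD(1)[OF X that(1)] that
    by (intro eq_vecI) (auto simp: resid_def h_def scalar_prod_def atLeast0LessThan intro!: sum.cong)
  have "(\<lambda>\<omega>. \<Sum>i<n. h k i \<omega> * h l i \<omega>) \<in> borel_measurable M"
    using h kl by (intro borel_measurable_sum borel_measurable_times) auto
  also have "?this \<longleftrightarrow> ?thesis"
    using kl by (intro measurable_cong) (simp add: eq scalar_prod_def atLeast0LessThan)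
  finally show ?thesis .
qed

section \<open>Closed sets, projections along compact sets, and the infimum\<close>

lemma closed_Collect_ball:
  assumes "\<And>k. k \<in> C \<Longrightarrow> closed {x. P k x}"
  shows "closed {x. \<forall>k\<in>C. P k x}"
proof -
  have "{x. \<forall>k\<in>C. P k x} = (\<Inter>k\<in>C. {x. P k x})" by auto
  then show ?thesis using assms by auto
qed

text \<open>Projection along a compact factor is a closed map. An existential quantifier over
  uncountably many vectors thereby still defines a Borel set.\<close>

lemma closed_projection_compact:
  fixes S :: "'b::topological_space set" and T :: "('b \<times> 'c::topological_space) set"
  assumes S: "compact S" and T: "closed T"
  shows "closed {y. \<exists>x\<in>S. (x, y) \<in> T}"
proof -
  have "closed_map (prod_topology (top_of_set S) euclidean) euclidean snd"
    using S by (intro Abstract_Topological_Spaces.closed_map_snd) (simp add: compact_space_subtopology)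
  moreover have "closedin (prod_topology (top_of_set S) euclidean) ((S \<times> UNIV) \<inter> T)"
  proof -
    have eq: "prod_topology (top_of_set S) (euclidean :: 'c topology) = top_of_set (S \<times> UNIV)"
      by (metis prod_topology_subtopology_eu subtopology_UNIV)
    show ?thesis unfolding eq using T by (rule closedin_closed_Int)
  qed
  ultimately have "closedin euclidean (snd ` ((S \<times> UNIV) \<inter> T))"
    unfolding closed_map_def by blast
  moreover have "snd ` ((S \<times> UNIV) \<inter> T) = {y. \<exists>x\<in>S. (x, y) \<in> T}" by force
  ultimately show ?thesis by simp
qed

lemma continuous_on_fst_coord: "continuous_on A (\<lambda>x. fst x i)"
  for i :: 'i and A :: "(('i \<Rightarrow> 'b::topological_space) \<times> 'c::topological_space) set"
  by (rule continuous_on_product_then_coordinatewise) (rule continuous_on_fst[OF continuous_on_id])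

lemma continuous_on_snd_coord: "continuous_on A (\<lambda>x. snd x i)"
  for i :: 'i and A :: "('c::topological_space \<times> ('i \<Rightarrow> 'b::topological_space)) set"
  by (rule continuous_on_product_then_coordinatewise) (rule continuous_on_snd[OF continuous_on_id])

text \<open>The event is a statement about an uncountable infimum. Its complement is a countable union of
  preimages, under the measurable Gram matrix \<open>G\<close>, of sets \<open>{G. \<exists>u\<in>box R. (u, G) \<in> H R m}\<close>, which are
  closed as projections of a closed set along a compact one.\<close>
lemma sets_scif2_ge:
  fixes c :: real
  assumes X: "measurable_mat M n p X"
  shows "{\<omega> \<in> space M. scif2 (X \<omega>) S j \<xi> T \<ge> ereal c} \<in> sets M"
proof -
  define C where "C = coords p S j"
  have finC: "finite C" and Cp: "C \<subseteq> {..<p}" by (auto simp: C_def coords_def)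
  define ga where "ga = (\<lambda>(G :: nat \<times> nat \<Rightarrow> real) u k. (\<Sum>l\<in>C. G (k, l) * u l) / real n)"
  define G where "G = (\<lambda>\<omega> (k, l). if k \<in> C \<and> l \<in> C then
    scalar_prod (resid (X \<omega>) S j k) (resid (X \<omega>) S j l) else 0)"
  have Gm: "G \<in> borel_measurable M"
  proof (rule measurable_coordinatewise_then_product)
    fix kl :: "nat \<times> nat"
    show "(\<lambda>\<omega>. G \<omega> kl) \<in> borel_measurable M"
      using resid_inner_measurable[OF X, of "fst kl" "snd kl" S j] Cp
      by (cases "fst kl \<in> C \<and> snd kl \<in> C") (auto simp: G_def case_prod_beta)
  qed
  define cone where "cone = (\<lambda>G u. (\<forall>k\<in>C - T. u k * ga G u k \<le> 0) \<and>
    (\<Sum>k\<in>C - T. \<bar>u k\<bar>) \<le> \<xi> * (\<Sum>k\<in>T. \<bar>u k\<bar>))"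
  \<comment> \<open>The strict inequality and the condition u /= 0 are replaced by closed versions
    with gaps 1/(m+1) and 1/(R+1), which the countable union removes again. The maximum becomes a
    conjunction and the quotient is cleared, so every condition is visibly closed.\<close>
  define H where "H = (\<lambda>R m. {x. cone (snd x) (fst x) \<and> 1 / real (Suc R) \<le> L2_set (fst x) C \<and>
    (\<forall>k\<in>C. sqrt (card T) * \<bar>ga (snd x) (fst x) k\<bar> \<le> (c - 1 / real (Suc m)) * L2_set (fst x) C)})"
  \<comment> \<open>Outside \<open>C\<close> the value is \<open>undefined\<close>, as for the
    extensional functions in \<open>sign_cone\<close>.\<close>
  define box where "box = (\<lambda>R::nat. {u::nat \<Rightarrow> real. \<forall>i. u i \<in> (if i \<in> C then {- real R..real R} else {undefined})})"
  define B where "B = (\<lambda>R m. {G. \<exists>u\<in>box R. (u, G) \<in> H R m})"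
  have cu: "continuous_on UNIV (\<lambda>x :: (nat \<Rightarrow> real) \<times> (nat \<times> nat \<Rightarrow> real). fst x k)" for k
    by (rule continuous_on_fst_coord)
  have cga: "continuous_on UNIV (\<lambda>x. ga (snd x) (fst x) k)" for k
    unfolding ga_def divide_inverse
    by (intro continuous_on_mult continuous_on_sum continuous_on_const cu continuous_on_snd_coord)
  have cL: "continuous_on UNIV (\<lambda>x :: (nat \<Rightarrow> real) \<times> (nat \<times> nat \<Rightarrow> real). L2_set (fst x) C)"
    unfolding L2_set_def by (intro continuous_on_real_sqrt continuous_on_sum continuous_on_power cu)
  have "closed (H R m)" for R m
    unfolding H_def cone_def
    by (intro closed_Collect_conj closed_Collect_ball closed_Collect_le continuous_on_mult
        continuous_on_sum continuous_on_rabs continuous_on_const cu cga cL)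
  moreover have "compact (box R)" for R
    unfolding box_def by (rule compact_real_box) auto
  ultimately have "closed (B R m)" for R m
    unfolding B_def by (intro closed_projection_compact)
  then have "G -` B R m \<inter> space M \<in> sets M" for R m
    using Gm by (intro measurable_sets) auto
  then have meas: "(\<Union>R. \<Union>m. G -` B R m \<inter> space M) \<in> sets M"
    by (intro sets.countable_UN'') auto
  have iff: "\<not> scif2 (X \<omega>) S j \<xi> T \<ge> ereal c \<longleftrightarrow> (\<exists>R m. G \<omega> \<in> B R m)" if \<omega>: "\<omega> \<in> space M" for \<omega>
  proof -
    have dims: "dim_row (X \<omega>) = n" "dim_col (X \<omega>) = p" using measurable_matD(1)[OF X \<omega>] by auto
    have ga: "gram_app (X \<omega>) S j u k = ga (G \<omega>) u k" if "k \<in> C" for u k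
      using that by (auto simp: gram_app_def ga_def dims C_def[symmetric] G_def intro!: sum.cong)
    have mem: "u \<in> sign_cone (X \<omega>) S j \<xi> T \<longleftrightarrow>
        u \<in> C \<rightarrow>\<^sub>E UNIV \<and> (\<exists>k\<in>C. u k \<noteq> 0) \<and> cone (G \<omega>) u" for u
      by (auto simp: sign_cone_def dims C_def[symmetric] cone_def ga)
    have max: "(MAX k\<in>C. \<bar>gram_app (X \<omega>) S j u k\<bar>) = (MAX k\<in>C. \<bar>ga (G \<omega>) u k\<bar>)" for u
      by (intro arg_cong[where f=Max] image_cong) (auto simp: ga)
    define F where "F = (\<lambda>u. sqrt (card T) * (MAX k\<in>C. \<bar>ga (G \<omega>) u k\<bar>) / L2_set u C)"
    have "\<not> scif2 (X \<omega>) S j \<xi> T \<ge> ereal c \<longleftrightarrow> (\<exists>u\<in>sign_cone (X \<omega>) S j \<xi> T. F u < c)"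
      by (simp add: scif2_def dims C_def[symmetric] max F_def not_le INF_less_iff)
    also have "\<dots> \<longleftrightarrow> (\<exists>R m. G \<omega> \<in> B R m)"
    proof
      assume "\<exists>u\<in>sign_cone (X \<omega>) S j \<xi> T. F u < c"
      then obtain u where "u \<in> sign_cone (X \<omega>) S j \<xi> T" "F u < c" by blast
      then have u: "u \<in> C \<rightarrow>\<^sub>E UNIV" "\<exists>k\<in>C. u k \<noteq> 0" "cone (G \<omega>) u" "F u < c"
        unfolding mem by simp_all
      have pos: "L2_set u C > 0"
        using u(2) finC L2_set_eq_0_iff[of C u] L2_set_nonneg[of u C] by (auto simp: order_less_le)
      obtain m where m: "1 / real (Suc m) < c - F u"
        using reals_Archimedean[of "c - F u"] u(4) by (auto simp: inverse_eq_divide)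
      obtain R1 where R1: "1 / real (Suc R1) < L2_set u C"
        using reals_Archimedean[OF pos] by (auto simp: inverse_eq_divide)
      obtain R2 where R2: "(\<Sum>k\<in>C. \<bar>u k\<bar>) \<le> real R2" using real_arch_simple by blast
      define R where "R = max R1 R2"
      have "1 / real (Suc R) \<le> 1 / real (Suc R1)" by (intro divide_left_mono) (auto simp: R_def)
      then have l: "1 / real (Suc R) \<le> L2_set u C" using R1 by linarith
      have "\<bar>u k\<bar> \<le> real R" if "k \<in> C" for k
      proof -
        have "\<bar>u k\<bar> \<le> (\<Sum>k\<in>C. \<bar>u k\<bar>)" using that finC by (intro member_le_sum) auto
        then show ?thesis using R2 by (simp add: R_def)
      qed
      then have "u \<in> box R" using u(1) by (force simp: box_def abs_le_iff PiE_def extensional_def)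
      moreover have "sqrt (card T) * \<bar>ga (G \<omega>) u k\<bar> \<le> (c - 1 / real (Suc m)) * L2_set u C" if "k \<in> C" for k
      proof -
        have "sqrt (card T) * \<bar>ga (G \<omega>) u k\<bar> \<le> sqrt (card T) * (MAX k\<in>C. \<bar>ga (G \<omega>) u k\<bar>)"
          using that finC by (intro mult_left_mono Max_ge) auto
        also have "\<dots> = F u * L2_set u C" using pos by (simp add: F_def)
        also have "\<dots> \<le> (c - 1 / real (Suc m)) * L2_set u C" using m pos by (intro mult_right_mono) auto
        finally show ?thesis .
      qed
      ultimately have "G \<omega> \<in> B R m" using u l by (auto simp: B_def H_def)
      then show "\<exists>R m. G \<omega> \<in> B R m" by blast
    next
      assume "\<exists>R m. G \<omega> \<in> B R m"
      then obtain R m u where u: "u \<in> box R" "cone (G \<omega>) u" "1 / real (Suc R) \<le> L2_set u C"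
        "\<And>k. k \<in> C \<Longrightarrow> sqrt (card T) * \<bar>ga (G \<omega>) u k\<bar> \<le> (c - 1 / real (Suc m)) * L2_set u C"
        by (auto simp: B_def H_def)
      have "0 < 1 / real (Suc R)" by simp
      then have pos: "L2_set u C > 0" using u(3) by linarith
      then have nz: "\<exists>k\<in>C. u k \<noteq> 0" using L2_set_eq_0_iff[OF finC, of u] by force
      have "(MAX k\<in>C. \<bar>ga (G \<omega>) u k\<bar>) \<in> (\<lambda>k. \<bar>ga (G \<omega>) u k\<bar>) ` C"
        using nz finC by (intro Max_in) auto
      then obtain k where "k \<in> C" "(MAX k\<in>C. \<bar>ga (G \<omega>) u k\<bar>) = \<bar>ga (G \<omega>) u k\<bar>" by auto
      then have "F u \<le> c - 1 / real (Suc m)" using u(4)[of k] pos by (simp add: F_def divide_le_eq)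
      moreover have "1 / real (Suc m) > 0" by simp
      ultimately have "F u < c" by linarith
      moreover have "u \<in> C \<rightarrow>\<^sub>E UNIV" using u(1) by (auto simp: box_def PiE_def extensional_def split: if_splits)
      ultimately have "u \<in> sign_cone (X \<omega>) S j \<xi> T" "F u < c" using u(2) nz unfolding mem by simp_all
      then show "\<exists>u\<in>sign_cone (X \<omega>) S j \<xi> T. F u < c" by blast
    qed
    finally show ?thesis .
  qed
  have "{\<omega> \<in> space M. scif2 (X \<omega>) S j \<xi> T \<ge> ereal c} = space M - (\<Union>R. \<Union>m. G -` B R m \<inter> space M)"
    using iff by auto
  then show ?thesis using meas by auto
qed

section \<open>The residual Gram matrix\<close>

lemma resid_carrier: "X \<in> carrier_mat n p \<Longrightarrow> resid X S j k \<in> carrier_vec n"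
  by (intro carrier_vecI) (simp add: resid_def proj_mat_def Let_def dim_submatrix)

text \<open>By associativity the projection of x is X_A (N X_A^T x). Only the shape of this product
  matters, not that \<open>N\<close> is an inverse.\<close>

lemma resid_eq_col_minus_combination:
  assumes X: "X \<in> carrier_mat n p" and S: "S \<subseteq> {..<p}" and k: "k < p"
  shows "\<exists>v. \<forall>i<n. resid X S j k $ i = X $$ (i, k) - (\<Sum>l\<in>S - {j}. X $$ (i, l) * v l)"
proof -
  define A where "A = S - {j}"
  have A: "{l. l < p \<and> l \<in> A} = A" using S by (auto simp: A_def)
  have finA: "finite A" using finite_subset[OF S] by (simp add: A_def)
  define d where "d = card A"
  define XA where "XA = submatrix X UNIV A"
  have XA: "XA \<in> carrier_mat n d"
    using X A by (intro carrier_matI) (auto simp: XA_def dim_submatrix d_def)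
  define N where "N = mat_inv (transpose_mat XA * XA)"
  have N: "N \<in> carrier_mat d d" unfolding N_def using XA by (intro mat_inv_carrier) auto
  define x where "x = col X k"
  have x: "x \<in> carrier_vec n" unfolding x_def using X by (intro carrier_vecI) simp
  define y where "y = N *\<^sub>v (transpose_mat XA *\<^sub>v x)"
  have y: "y \<in> carrier_vec d" unfolding y_def using N XA x by auto
  have P: "proj_mat X A = XA * N * transpose_mat XA" by (simp add: proj_mat_def Let_def XA_def N_def)
  have Pc: "proj_mat X A \<in> carrier_mat n n" unfolding P using XA N by auto
  have Py: "proj_mat X A *\<^sub>v x = XA *\<^sub>v y"
  proof -
    have "proj_mat X A *\<^sub>v x = (XA * N) *\<^sub>v (transpose_mat XA *\<^sub>v x)"
      unfolding P using XA N x by (intro assoc_mult_mat_vec) auto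
    also have "\<dots> = XA *\<^sub>v y"
      unfolding y_def using XA N x by (intro assoc_mult_mat_vec) auto
    finally show ?thesis .
  qed
  have "resid X S j k = (1\<^sub>m n - proj_mat X A) *\<^sub>v x" using X by (simp add: resid_def A_def x_def)
  also have "\<dots> = 1\<^sub>m n *\<^sub>v x - proj_mat X A *\<^sub>v x" using Pc x by (intro minus_mult_distrib_mat_vec) auto
  finally have r: "resid X S j k = x - XA *\<^sub>v y" using x Py by simp
  \<comment> \<open>The number of smaller elements of \<open>A\<close> is the column position of
    \<open>l\<close> in the submatrix, the inverse of \<open>pick A\<close>.\<close>
  define v where "v = (\<lambda>l. y $ card {a \<in> A. a < l})"
  have "resid X S j k $ i = X $$ (i, k) - (\<Sum>l\<in>A. X $$ (i, l) * v l)" if i: "i < n" for i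
  proof -
    have "(XA *\<^sub>v y) $ i = (\<Sum>q<d. XA $$ (i, q) * y $ q)"
      using XA y i by (auto simp: scalar_prod_def atLeast0LessThan intro!: sum.cong)
    also have "\<dots> = (\<Sum>q<d. X $$ (i, pick A q) * y $ q)"
      using X A i by (intro sum.cong refl) (auto simp: XA_def d_def submatrix_index pick_UNIV)
    also have "\<dots> = (\<Sum>l\<in>A. X $$ (i, l) * v l)"
    proof (rule sum.reindex_bij_witness[where j="pick A" and i="\<lambda>l. card {a \<in> A. a < l}"])
      fix q assume "q \<in> {..<d}"
      then have q: "q < card A" by (simp add: d_def)
      show "card {a \<in> A. a < pick A q} = q" "pick A q \<in> A"
        using card_pick_le[OF q] pick_in_set_le[OF q] by auto
      then show "X $$ (i, pick A q) * v (pick A q) = X $$ (i, pick A q) * y $ q" by (simp add: v_def)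
    next
      fix l assume l: "l \<in> A"
      show "pick A (card {a \<in> A. a < l}) = l" using l by (rule pick_card_in_set)
      have "{a \<in> A. a < l} \<subset> A" using l by auto
      then show "card {a \<in> A. a < l} \<in> {..<d}" using finA by (simp add: d_def psubset_card_mono)
    qed
    finally show ?thesis using i x X XA k unfolding r by (simp add: x_def)
  qed
  then show ?thesis unfolding A_def by blast
qed

text \<open>\<open>\<psi> u\<close> differs from \<open>X\<^sub>C u\<close> by an element of the column space of \<open>X\<^sub>A\<close>, whatever value
  \<open>mat_inv\<close> takes on a singular matrix.\<close>
lemma gram_app_quadratic_form:
  assumes X: "X \<in> carrier_mat n p" and S: "S \<subseteq> {..<p}"
  shows "\<exists>w. (\<forall>k\<in>coords p S j. w k = u k) \<and> (\<forall>k. k \<notin> (S - {j}) \<union> coords p S j \<longrightarrow> w k = 0) \<and>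
    (\<Sum>k\<in>coords p S j. u k * gram_app X S j u k) = (\<Sum>i<n. (design_app p X w i)\<^sup>2) / n"
proof -
  define A where "A = S - {j}"
  define C where "C = coords p S j"
  have fin: "finite A" "finite C" and sub: "A \<union> C \<subseteq> {..<p}" and disj: "A \<inter> C = {}"
    using S finite_subset[OF S] by (auto simp: A_def C_def coords_def)
  have "\<forall>k\<in>C. \<exists>v. \<forall>i<n. resid X S j k $ i = X $$ (i, k) - (\<Sum>l\<in>A. X $$ (i, l) * v l)"
    unfolding A_def using resid_eq_col_minus_combination[OF X S] sub by (auto simp: C_def)
  then obtain v where v: "\<And>k i. k \<in> C \<Longrightarrow> i < n \<Longrightarrow>
      resid X S j k $ i = X $$ (i, k) - (\<Sum>l\<in>A. X $$ (i, l) * v k l)"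
    by metis
  \<comment> \<open>On \<open>A\<close> the vector collects the coefficients subtracted by the
    projection from all columns in \<open>C\<close>. At \<open>j\<close>, which lies in neither set,
    it is 0.\<close>
  define w where "w = (\<lambda>l. if l \<in> C then u l else if l \<in> A then - (\<Sum>k\<in>C. u k * v k l) else 0)"
  have des: "design_app p X w i = (\<Sum>k\<in>C. u k * resid X S j k $ i)" if i: "i < n" for i
  proof -
    have "design_app p X w i = (\<Sum>l\<in>A \<union> C. X $$ (i, l) * w l)"
      unfolding design_app_def using sub by (intro sum.mono_neutral_right) (auto simp: w_def)
    also have "\<dots> = (\<Sum>l\<in>A. X $$ (i, l) * w l) + (\<Sum>l\<in>C. X $$ (i, l) * w l)"
      using fin disj by (intro sum.union_disjoint) auto
    also have "(\<Sum>l\<in>A. X $$ (i, l) * w l) = (\<Sum>l\<in>A. \<Sum>k\<in>C. - (X $$ (i, l) * (u k * v k l)))"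
      using disj by (intro sum.cong refl) (auto simp: w_def sum_distrib_left sum_negf)
    also have "\<dots> = (\<Sum>k\<in>C. \<Sum>l\<in>A. - (X $$ (i, l) * (u k * v k l)))" by (rule sum.swap)
    also have "(\<Sum>l\<in>C. X $$ (i, l) * w l) = (\<Sum>k\<in>C. X $$ (i, k) * u k)"
      by (intro sum.cong) (auto simp: w_def)
    also have "(\<Sum>k\<in>C. \<Sum>l\<in>A. - (X $$ (i, l) * (u k * v k l))) + (\<Sum>k\<in>C. X $$ (i, k) * u k)
        = (\<Sum>k\<in>C. u k * resid X S j k $ i)"
      unfolding sum.distrib[symmetric] using i
      by (intro sum.cong refl) (simp add: v algebra_simps sum_distrib_left sum_negf)
    finally show ?thesis .
  qed
  have "(\<Sum>i<n. (design_app p X w i)\<^sup>2) =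
      (\<Sum>i<n. \<Sum>k\<in>C. \<Sum>l\<in>C. (u k * resid X S j k $ i) * (u l * resid X S j l $ i))"
    by (intro sum.cong refl) (simp add: des power2_eq_square sum_product)
  also have "\<dots> = (\<Sum>k\<in>C. \<Sum>l\<in>C. \<Sum>i<n. (u k * resid X S j k $ i) * (u l * resid X S j l $ i))"
    by (subst sum.swap, rule sum.cong[OF refl], rule sum.swap)
  also have "\<dots> = (\<Sum>k\<in>C. \<Sum>l\<in>C. u k * (scalar_prod (resid X S j k) (resid X S j l) * u l))"
    by (intro sum.cong refl) (simp add: scalar_prod_def atLeast0LessThan sum_distrib_left sum_distrib_right
        mult_ac carrier_vecD[OF resid_carrier[OF X]])
  also have "\<dots> / n = (\<Sum>k\<in>C. u k * gram_app X S j u k)"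
    using X by (simp add: gram_app_def C_def sum_divide_distrib sum_distrib_left)
  finally show ?thesis
    by (intro exI[of _ w]) (simp add: C_def[symmetric] A_def[symmetric] w_def)
qed

text \<open>The two conditions of the cone separate here: the sign condition discards the terms
  outside \<open>T\<close> from the quadratic form, while the l1 condition is passed on to
  \<open>RE\<close>.\<close>

lemma scif2_ge_of_restricted_eigenvalue:
  fixes c :: real
  assumes X: "X \<in> carrier_mat n p" and S: "S \<subseteq> {..<p}" and T: "T \<subseteq> coords p S j"
    and RE: "\<And>w. (\<And>k. k \<notin> (S - {j}) \<union> coords p S j \<Longrightarrow> w k = 0) \<Longrightarrow>
      (\<Sum>k\<in>coords p S j - T. \<bar>w k\<bar>) \<le> \<xi> * (\<Sum>k\<in>T. \<bar>w k\<bar>) \<Longrightarrow>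
      c * (L2_set w (coords p S j))\<^sup>2 \<le> (\<Sum>i<n. (design_app p X w i)\<^sup>2) / n"
  shows "ereal c \<le> scif2 X S j \<xi> T"
proof -
  define C where "C = coords p S j"
  have finC: "finite C" by (auto simp: C_def coords_def)
  have dims: "dim_row X = n" "dim_col X = p" using X by auto
  have "c \<le> sqrt (card T) * (MAX k\<in>C. \<bar>gram_app X S j u k\<bar>) / L2_set u C"
    if u: "u \<in> sign_cone X S j \<xi> T" for u
  proof -
    define g where "g = gram_app X S j u"
    define G where "G = (MAX k\<in>C. \<bar>g k\<bar>)"
    have nz: "\<exists>k\<in>C. u k \<noteq> 0" and cone: "(\<Sum>k\<in>C - T. \<bar>u k\<bar>) \<le> \<xi> * (\<Sum>k\<in>T. \<bar>u k\<bar>)"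
      and sign: "\<And>k. k \<in> C - T \<Longrightarrow> u k * g k \<le> 0"
      using u by (simp_all add: sign_cone_def dims C_def g_def)
    have pos: "L2_set u C > 0"
      using nz finC L2_set_eq_0_iff[of C u] L2_set_nonneg[of u C] by (auto simp: order_less_le)
    have gG: "\<bar>g k\<bar> \<le> G" if "k \<in> C" for k
      unfolding G_def using finC that by (intro Max_ge) auto
    have G0: "G \<ge> 0" using nz gG by (meson abs_ge_zero order_trans)
    obtain w where w: "\<And>k. k \<in> C \<Longrightarrow> w k = u k" "\<And>k. k \<notin> (S - {j}) \<union> C \<Longrightarrow> w k = 0"
      "(\<Sum>k\<in>C. u k * g k) = (\<Sum>i<n. (design_app p X w i)\<^sup>2) / n"
      using gram_app_quadratic_form[OF X S, of j u] unfolding C_def g_def by metis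
    have wu: "L2_set w C = L2_set u C" using w(1) by (intro L2_set_cong) auto
    have "(\<Sum>k\<in>C - T. \<bar>w k\<bar>) = (\<Sum>k\<in>C - T. \<bar>u k\<bar>)" using w(1) by (intro sum.cong) auto
    moreover have "(\<Sum>k\<in>T. \<bar>w k\<bar>) = (\<Sum>k\<in>T. \<bar>u k\<bar>)"
      using w(1) T by (intro sum.cong) (auto simp: C_def)
    ultimately have "c * (L2_set w C)\<^sup>2 \<le> (\<Sum>i<n. (design_app p X w i)\<^sup>2) / n"
      using w(2) cone unfolding C_def by (intro RE) auto
    then have "c * (L2_set u C)\<^sup>2 \<le> (\<Sum>k\<in>C. u k * g k)" unfolding wu w(3) .
    also have "\<dots> = (\<Sum>k\<in>C - T. u k * g k) + (\<Sum>k\<in>T. u k * g k)"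
      using T finC by (intro sum.subset_diff) (auto simp: C_def)
    also have "\<dots> \<le> (\<Sum>k\<in>T. u k * g k)" using sum_nonpos[of "C - T", OF sign] by simp
    also have "\<dots> \<le> (\<Sum>k\<in>T. \<bar>u k\<bar> * G)"
    proof (intro sum_mono)
      fix k assume "k \<in> T"
      then have "k \<in> C" using T by (auto simp: C_def)
      have "u k * g k \<le> \<bar>u k\<bar> * \<bar>g k\<bar>" by (metis abs_ge_self abs_mult)
      also have "\<dots> \<le> \<bar>u k\<bar> * G" using gG[OF \<open>k \<in> C\<close>] by (intro mult_left_mono) auto
      finally show "u k * g k \<le> \<bar>u k\<bar> * G" .
    qed
    also have "\<dots> = (\<Sum>k\<in>T. \<bar>u k\<bar>) * G" by (simp add: sum_distrib_right)
    also have "\<dots> \<le> (sqrt (card T) * L2_set u C) * G"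
    proof (intro mult_right_mono G0)
      have "(\<Sum>k\<in>T. \<bar>u k\<bar>) \<le> sqrt (card T) * L2_set u T" by (rule L1_le_sqrt_card_L2)
      also have "\<dots> \<le> sqrt (card T) * L2_set u C"
        using T finC by (intro mult_left_mono L2_set_mono_set) (auto simp: C_def)
      finally show "(\<Sum>k\<in>T. \<bar>u k\<bar>) \<le> sqrt (card T) * L2_set u C" .
    qed
    finally have "(c * L2_set u C) * L2_set u C \<le> (sqrt (card T) * G) * L2_set u C"
      by (simp add: power2_eq_square mult_ac)
    then have "c * L2_set u C \<le> sqrt (card T) * G" using pos by simp
    then show ?thesis using pos by (simp add: G_def g_def pos_le_divide_eq)
  qed
  then show ?thesis
    unfolding scif2_def dims C_def[symmetric] by (intro INF_greatest) simp
qed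

section \<open>The restricted eigenvalue bound with high probability\<close>

definition sample_norm :: "nat \<Rightarrow> nat \<Rightarrow> real mat \<Rightarrow> (nat \<Rightarrow> real) \<Rightarrow> real" where
  "sample_norm n p X w = L2_set (design_app p X w) {..<n} / sqrt n"

lemma fun_seminorm_sample_norm: "fun_seminorm (sample_norm n p X)"
proof
  fix u v :: "nat \<Rightarrow> real" and c :: real
  have "design_app p X (\<lambda>i. u i + v i) = (\<lambda>i. design_app p X u i + design_app p X v i)"
    by (simp add: design_app_def fun_eq_iff algebra_simps sum.distrib)
  then show "sample_norm n p X (\<lambda>i. u i + v i) \<le> sample_norm n p X u + sample_norm n p X v"
    using L2_set_triangle_ineq[of "design_app p X u" "design_app p X v" "{..<n}"]
    by (simp add: sample_norm_def add_divide_distrib[symmetric] divide_right_mono)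
  have "design_app p X (\<lambda>i. c * u i) = (\<lambda>i. c * design_app p X u i)"
    by (simp add: design_app_def fun_eq_iff sum_distrib_left mult_ac)
  moreover have "L2_set (\<lambda>i. c * g i) A = \<bar>c\<bar> * L2_set g A" for g :: "nat \<Rightarrow> real" and A
    using L2_set_right_distrib[of "\<bar>c\<bar>" g A] by (simp add: L2_set_def power_mult_distrib)
  ultimately show "sample_norm n p X (\<lambda>i. c * u i) = \<bar>c\<bar> * sample_norm n p X u"
    by (simp add: sample_norm_def)
qed

text \<open>Cauchy-Schwarz with the Frobenius norm of \<open>X\<close>. It only provides the finite
  constant \<open>K\<close> that \<open>net_bounds\<close> asks for.\<close>

lemma sample_norm_le_L2:
  "sample_norm n p X w \<le> L2_set (\<lambda>i. L2_set (\<lambda>k. X $$ (i, k)) {..<p}) {..<n} / sqrt n * L2_set w {..<p}"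
proof -
  have "\<bar>design_app p X w i\<bar> \<le> L2_set (\<lambda>k. X $$ (i, k)) {..<p} * L2_set w {..<p}" for i
  proof -
    have "\<bar>design_app p X w i\<bar> \<le> (\<Sum>k<p. \<bar>X $$ (i, k)\<bar> * \<bar>w k\<bar>)"
      unfolding design_app_def abs_mult[symmetric] by (rule sum_abs)
    also have "\<dots> \<le> L2_set (\<lambda>k. X $$ (i, k)) {..<p} * L2_set w {..<p}" by (rule L2_set_mult_ineq)
    finally show ?thesis .
  qed
  then have "L2_set (\<lambda>i. \<bar>design_app p X w i\<bar>) {..<n} \<le>
      L2_set (\<lambda>i. L2_set (\<lambda>k. X $$ (i, k)) {..<p} * L2_set w {..<p}) {..<n}"
    by (intro L2_set_mono) auto
  also have "\<dots> = L2_set (\<lambda>i. L2_set (\<lambda>k. X $$ (i, k)) {..<p}) {..<n} * L2_set w {..<p}"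
    by (simp add: L2_set_left_distrib)
  finally have "L2_set (design_app p X w) {..<n} \<le> \<dots>" by (simp add: L2_set_def)
  then show ?thesis by (simp add: sample_norm_def divide_right_mono)
qed

text \<open>The net turns (l, \<open>\<Lambda>\<close>) into (l/4, 3 \<open>\<Lambda>\<close>). For
  these values \<open>restricted_eigenvalue\<close> requires 8 * 3 \<open>\<Lambda>\<close> *
  \<open>\<eta>\<close> <= l/4, hence the 96, and yields l/16. Sparse bounds are proved with all of
  \<open>S\<close>, not with S - {j}, so that the assumption on the net is free of
  \<open>j\<close>.\<close>

lemma scif2_ge_of_net:
  fixes l \<Lambda> \<epsilon> \<eta> \<xi> :: real
  assumes X: "X \<in> carrier_mat n p" and S: "S \<subseteq> {..<p}" and T: "T \<subseteq> coords p S j" "card T \<le> s"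
    and m: "m > 0" and l: "l \<ge> 0" and \<Lambda>: "\<Lambda> \<ge> 0" and xi: "\<xi> \<ge> 0"
    and eps: "0 < \<epsilon>" "\<epsilon> \<le> 1/2" "12 * \<Lambda> * \<epsilon> \<le> l"
    and eta: "(1 + \<xi>) * sqrt s \<le> \<eta> * sqrt m" "\<eta> \<le> 1/2" "96 * \<Lambda> * \<eta> \<le> l"
    and net: "\<And>z. z \<in> sparse_net p S m (nat \<lfloor>(1 / \<epsilon>\<^sup>2 + 2) * (card S + m)\<rfloor>) \<Longrightarrow>
      l * L2_set (\<lambda>i. real_of_int (z i)) {..<p} \<le> sample_norm n p X (\<lambda>i. real_of_int (z i)) \<and>
      sample_norm n p X (\<lambda>i. real_of_int (z i)) \<le> \<Lambda> * L2_set (\<lambda>i. real_of_int (z i)) {..<p}"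
  shows "ereal ((l / 16)\<^sup>2) \<le> scif2 X S j \<xi> T"
proof -
  interpret fun_seminorm "sample_norm n p X" by (rule fun_seminorm_sample_norm)
  define A where "A = S - {j}"
  define C where "C = coords p S j"
  have finS: "finite S" using S finite_subset by blast
  have fin: "finite A" "finite C" and disj: "A \<inter> C = {}" and Cp: "C \<subseteq> {..<p}" and AS: "A \<subseteq> S"
    and CS: "C \<inter> S = {}"
    using finS by (auto simp: A_def C_def coords_def)
  have bounds: "sample_norm n p X v \<le> 3 * \<Lambda> * L2_set v (S \<union> B) \<and> l / 4 * L2_set v (S \<union> B) \<le> sample_norm n p X v"
    if B: "B \<subseteq> C" "card B \<le> m" and v: "\<And>i. i \<notin> S \<union> B \<Longrightarrow> v i = 0" for v B
  proof -
    define U where "U = S \<union> B"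
    have finB: "finite B" using B(1) fin(2) by (rule finite_subset)
    have U: "finite U" "U \<subseteq> {..<p}" using finS finB S B Cp by (auto simp: U_def)
    have cardU: "card U \<le> card S + m" using card_Un_le[of S B] B by (simp add: U_def)
    have L2U: "L2_set g U = L2_set g {..<p}" if "\<And>i. i \<notin> U \<Longrightarrow> g i = 0" for g
      using U that by (intro L2_set_mono_neutral) auto
    have Kb: "sample_norm n p X w \<le> L2_set (\<lambda>i. L2_set (\<lambda>k. X $$ (i, k)) {..<p}) {..<n} / sqrt n * L2_set w U"
      if "\<And>i. i \<notin> U \<Longrightarrow> w i = 0" for w
      using sample_norm_le_L2[of n p X w] L2U[OF that] by simp
    have netU: "l * L2_set (\<lambda>i. real_of_int (z i)) U \<le> sample_norm n p X (\<lambda>i. real_of_int (z i)) \<and>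
        sample_norm n p X (\<lambda>i. real_of_int (z i)) \<le> \<Lambda> * L2_set (\<lambda>i. real_of_int (z i)) U"
      if z: "\<And>i. i \<notin> U \<Longrightarrow> z i = 0" "real_of_int (\<Sum>i\<in>U. \<bar>z i\<bar>) \<le> (1 / \<epsilon>\<^sup>2 + 2) * real (card S + m)"
      for z :: "nat \<Rightarrow> int"
    proof -
      have "z \<in> sparse_net p S m (nat \<lfloor>(1 / \<epsilon>\<^sup>2 + 2) * (card S + m)\<rfloor>)"
        unfolding sparse_net_def mem_Collect_eq
      proof (intro conjI allI impI)
        show "z i = 0" if "i \<notin> {..<p}" for i using that z(1) U by auto
        have "{i \<in> {..<p} - S. z i \<noteq> 0} \<subseteq> B" using z(1) by (auto simp: U_def)
        from card_mono[OF finB this] show "card {i \<in> {..<p} - S. z i \<noteq> 0} \<le> m" using B(2) by linarith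
        have "(\<Sum>i<p. \<bar>z i\<bar>) = (\<Sum>i\<in>U. \<bar>z i\<bar>)"
          using U z(1) by (intro sum.mono_neutral_right) auto
        also have "\<dots> \<le> \<lfloor>(1 / \<epsilon>\<^sup>2 + 2) * real (card S + m)\<rfloor>" using z(2) by (simp add: le_floor_iff)
        finally show "(\<Sum>i<p. \<bar>z i\<bar>) \<le> int (nat \<lfloor>(1 / \<epsilon>\<^sup>2 + 2) * real (card S + m)\<rfloor>)" by linarith
      qed
      from net[OF this] show ?thesis using L2U[of "\<lambda>i. real_of_int (z i)"] z(1) by simp
    qed
    have "card S + m > 0" using m by simp
    from net_bounds[OF U(1) cardU this eps l \<Lambda> Kb netU, of v] v show ?thesis by (simp add: U_def)
  qed
  show ?thesis
  proof (rule scif2_ge_of_restricted_eigenvalue[OF X S T(1)])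
    fix w assume supp: "\<And>k. k \<notin> (S - {j}) \<union> coords p S j \<Longrightarrow> w k = 0"
      and cone: "(\<Sum>k\<in>coords p S j - T. \<bar>w k\<bar>) \<le> \<xi> * (\<Sum>k\<in>T. \<bar>w k\<bar>)"
    have "l / 4 / 4 * L2_set w C \<le> sample_norm n p X w"
    proof (rule restricted_eigenvalue[OF fin disj _ T(2) m _ _ xi eta(1,2), where \<Lambda>="3 * \<Lambda>"])
      show "T \<subseteq> C" using T by (simp add: C_def)
      show "0 \<le> 3 * \<Lambda>" "0 \<le> l / 4" "8 * (3 * \<Lambda>) * \<eta> \<le> l / 4" using \<Lambda> l eta by auto
      show "w i = 0" if "i \<notin> A \<union> C" for i using supp that by (simp add: A_def C_def)
      show "(\<Sum>k\<in>C - T. \<bar>w k\<bar>) \<le> \<xi> * (\<Sum>k\<in>T. \<bar>w k\<bar>)" using cone by (simp add: C_def)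
      show "l / 4 * L2_set v (A \<union> B) \<le> sample_norm n p X v"
        if B: "B \<subseteq> C" "card B \<le> m" and v: "\<And>i. i \<notin> A \<union> B \<Longrightarrow> v i = 0" for v B
      proof -
        have "finite B" using B(1) fin(2) by (rule finite_subset)
        then have "L2_set v (A \<union> B) = L2_set v (S \<union> B)"
          using finS AS v by (intro L2_set_mono_neutral) auto
        then show ?thesis using bounds[OF B, of v] v AS by auto
      qed
      show "sample_norm n p X v \<le> 3 * \<Lambda> * L2_set v B"
        if B: "B \<subseteq> C" "card B \<le> m" and v: "\<And>i. i \<notin> B \<Longrightarrow> v i = 0" for v B
      proof -
        have "finite B" using B(1) fin(2) by (rule finite_subset)
        then have "L2_set v B = L2_set v (S \<union> B)"
          using finS v by (intro L2_set_mono_neutral) auto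
        then show ?thesis using bounds[OF B, of v] v by auto
      qed
    qed
    then have "(l / 16 * L2_set w C)\<^sup>2 \<le> (sample_norm n p X w)\<^sup>2"
      using l by (intro power_mono) auto
    also have "(sample_norm n p X w)\<^sup>2 = (\<Sum>i<n. (design_app p X w i)\<^sup>2) / n"
      by (simp add: sample_norm_def L2_set_def power_divide sum_nonneg)
    finally show "(l / 16)\<^sup>2 * (L2_set w (coords p S j))\<^sup>2 \<le> (\<Sum>i<n. (design_app p X w i)\<^sup>2) / n"
      by (simp only: power_mult_distrib C_def)
  qed
qed

text \<open>Union bound over the net. The concentration window v/8 to 4 v, together with the
  eigenvalue bounds on v, gives the two square roots.\<close>

lemma gaussian_design_net_event:
  fixes L :: real and Z :: "(nat \<Rightarrow> int) set"
  assumes M: "prob_space M" and G: "gaussian_design M n p C X" and n: "n > 0" and L: "L \<ge> 1"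
    and C: "\<And>w. 1 / L * (L2_set w {..<p})\<^sup>2 \<le> quad_form p C w"
      "\<And>w. quad_form p C w \<le> L * (L2_set w {..<p})\<^sup>2"
    and Z: "finite Z"
  shows "\<exists>E\<in>sets M. measure M E \<le> card Z * (2 * exp (- real n / 2)) \<and>
    (\<forall>\<omega>\<in>space M - E. \<forall>z\<in>Z.
      sqrt (1 / (8 * L)) * L2_set (\<lambda>i. real_of_int (z i)) {..<p} \<le> sample_norm n p (X \<omega>) (\<lambda>i. real_of_int (z i)) \<and>
      sample_norm n p (X \<omega>) (\<lambda>i. real_of_int (z i)) \<le> sqrt (4 * L) * L2_set (\<lambda>i. real_of_int (z i)) {..<p})"
proof -
  interpret prob_space M by fact
  define r where "r = (\<lambda>(z :: nat \<Rightarrow> int) i. real_of_int (z i))"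
  define Q where "Q = (\<lambda>z \<omega>. \<Sum>i<n. (design_app p (X \<omega>) (r z) i)\<^sup>2)"
  \<comment> \<open>Concentration needs a positive variance. It fails only for vectors vanishing on
    \<open>{..<p}\<close>, where both inequalities read 0 <= 0 and no exceptional event is
    needed.\<close>
  define E where "E = (\<lambda>z. if quad_form p C (r z) > 0 then
    {\<omega> \<in> space M. Q z \<omega> \<le> n * quad_form p C (r z) / 8 \<or> 4 * n * quad_form p C (r z) \<le> Q z \<omega>} else {})"
  have E: "E z \<in> sets M" "measure M (E z) \<le> 2 * exp (- real n / 2)" for z
    using gaussian_design_concentration[OF M G, of "r z"] by (auto simp: E_def Q_def)
  have "measure M (\<Union>z\<in>Z. E z) \<le> (\<Sum>z\<in>Z. measure M (E z))"
    using E Z by (intro finite_measure_subadditive_finite) auto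
  also have "\<dots> \<le> (\<Sum>z\<in>Z. 2 * exp (- real n / 2))" using E by (intro sum_mono)
  finally have "measure M (\<Union>z\<in>Z. E z) \<le> card Z * (2 * exp (- real n / 2))" by simp
  moreover have "(\<Union>z\<in>Z. E z) \<in> sets M" using E Z by auto
  moreover have "sqrt (1 / (8 * L)) * L2_set (r z) {..<p} \<le> sample_norm n p (X \<omega>) (r z) \<and>
      sample_norm n p (X \<omega>) (r z) \<le> sqrt (4 * L) * L2_set (r z) {..<p}"
    if \<omega>: "\<omega> \<in> space M - (\<Union>z\<in>Z. E z)" and z: "z \<in> Z" for \<omega> z
  proof (cases "quad_form p C (r z) > 0")
    case True
    define v where "v = quad_form p C (r z)"
    have sn: "sample_norm n p (X \<omega>) (r z) = sqrt (Q z \<omega> / n)"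
      by (simp add: sample_norm_def L2_set_def Q_def real_sqrt_divide)
    have "\<omega> \<notin> E z" using \<omega> z by blast
    then have Q: "n * v / 8 < Q z \<omega>" "Q z \<omega> < 4 * n * v" using \<omega> True by (simp_all add: E_def v_def)
    have L2: "sqrt a * L2_set (r z) {..<p} = sqrt (a * (L2_set (r z) {..<p})\<^sup>2)" for a
      by (simp add: real_sqrt_mult)
    have "1 / (8 * L) * (L2_set (r z) {..<p})\<^sup>2 \<le> v / 8" using C(1)[of "r z"] by (simp add: v_def)
    also have "\<dots> \<le> Q z \<omega> / n" using Q n by (simp add: field_simps)
    finally have 1: "sqrt (1 / (8 * L)) * L2_set (r z) {..<p} \<le> sample_norm n p (X \<omega>) (r z)"
      unfolding L2 sn by simp
    have "Q z \<omega> / n \<le> 4 * v" using Q n by (simp add: field_simps)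
    also have "\<dots> \<le> 4 * L * (L2_set (r z) {..<p})\<^sup>2" using C(2)[of "r z"] by (simp add: v_def)
    finally have 2: "sample_norm n p (X \<omega>) (r z) \<le> sqrt (4 * L) * L2_set (r z) {..<p}"
      unfolding L2 sn by simp
    show ?thesis using 1 2 by simp
  next
    case False
    then have "1 / L * (L2_set (r z) {..<p})\<^sup>2 \<le> 0" using C(1)[of "r z"] by linarith
    then have 0: "L2_set (r z) {..<p} = 0" using L by (simp add: divide_le_0_iff)
    then have "design_app p (X \<omega>) (r z) i = 0" for i
      by (simp add: L2_set_eq_0_iff design_app_def)
    then show ?thesis using 0 by (simp add: sample_norm_def L2_set_def)
  qed
  ultimately show ?thesis unfolding r_def by blast
qed

lemma card_nbrs_le_max_degree:
  assumes "\<Phi> \<in> carrier_mat p p" "j < p"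
  shows "card (nbrs \<Phi> S j) \<le> max_degree \<Phi>"
proof -
  have "card (nbrs \<Phi> S j) \<le> card {k. k < dim_row \<Phi> \<and> k \<noteq> j \<and> \<Phi> $$ (j, k) \<noteq> 0}"
    by (intro card_mono) (auto simp: nbrs_def coords_def)
  also have "\<dots> \<le> max_degree \<Phi>"
    unfolding max_degree_def using assms by (intro Max_ge) auto
  finally show ?thesis .
qed

theorem proposition2:
  fixes M :: "nat \<Rightarrow> 'a measure"
    and p :: "nat \<Rightarrow> nat"
    and X :: "nat \<Rightarrow> 'a \<Rightarrow> real mat"
    and \<Sigma> \<Phi> :: "nat \<Rightarrow> real mat"
    and S :: "nat \<Rightarrow> nat set"
    and \<xi> \<delta> L :: real
  assumes prob: "\<And>n. prob_space (M n)"
    and p_lim: "filterlim p at_top sequentially"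
    and S_sub: "\<And>n. S n \<subseteq> {..<p n}"
    and xi: "\<xi> \<ge> 0"
    and delta: "\<delta> > 1"
    and Sigma: "\<And>n. \<Sigma> n \<in> carrier_mat (p n) (p n)"
      "\<And>n. transpose_mat (\<Sigma> n) = \<Sigma> n"
    and Phi: "\<And>n. \<Phi> n \<in> carrier_mat (p n) (p n)"
      "\<And>n. inverts_mat (\<Sigma> n) (\<Phi> n)" "\<And>n. inverts_mat (\<Phi> n) (\<Sigma> n)"
    and design: "\<And>n. gaussian_design (M n) n (p n) (\<Sigma> n) (X n)"
    and L: "L \<ge> 1"
    and eigen: "\<And>n e. eigenvalue (\<Phi> n) e \<Longrightarrow> e \<in> {1 / L..L}"
    and s0_pos: "\<forall>\<^sub>F n in sequentially. max_degree (\<Phi> n) \<ge> 1"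
    and s0_small: "(\<lambda>n. real (max_degree (\<Phi> n)) * ln (real (p n)) / real n) \<in> o(\<lambda>_. 1)"
    and d_small: "(\<lambda>n. real (card (S n))) \<in> o(\<lambda>n. real n / real (max_degree (\<Phi> n)))"
  shows "\<exists>c>0. \<exists>r. r \<in> o(\<lambda>n. real (p n) powr (1 - \<delta>)) \<and>
    (\<forall>\<^sub>F n in sequentially. \<forall>j<p n.
       measure (M n) {\<omega> \<in> space (M n).
         scif2 (X n \<omega>) (S n) j \<xi> (nbrs (\<Phi> n) (S n) j) \<ge> ereal c} \<ge> 1 - r n)"
proof -
  define l \<Lambda> where "l = sqrt (1 / (8 * L))" and "\<Lambda> = sqrt (4 * L)"
  have l: "l > 0" and \<Lambda>: "\<Lambda> > 0" using L by (auto simp: l_def \<Lambda>_def)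
  \<comment> \<open>The largest values compatible with the smallness conditions of
    \<open>scif2_ge_of_net\<close>.\<close>
  define \<epsilon> where "\<epsilon> = min (1/2) (l / (12 * \<Lambda>))"
  define \<eta> where "\<eta> = min (1/2) (l / (96 * \<Lambda>))"
  have eps: "0 < \<epsilon>" "\<epsilon> \<le> 1/2" "12 * \<Lambda> * \<epsilon> \<le> l" and eta: "0 < \<eta>" "\<eta> \<le> 1/2" "96 * \<Lambda> * \<eta> \<le> l"
    using l \<Lambda> by (auto simp: \<epsilon>_def \<eta>_def min_def field_simps)
  define R where "R = 1 / \<epsilon>\<^sup>2 + 2"
  have R: "R \<ge> 0" by (simp add: R_def)
  \<comment> \<open>With K >= ((1 + \<open>\<xi>\<close>) / \<open>\<eta>\<close>)^2 the block
    length K * s satisfies the cone requirement for every \<open>s\<close>.\<close>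
  obtain K0 :: nat where K0: "((1 + \<xi>) / \<eta>)\<^sup>2 \<le> real K0" using real_arch_simple by blast
  define K where "K = Suc K0"
  have K: "K > 0" "1 + \<xi> \<le> \<eta> * sqrt K"
  proof -
    have "(1 + \<xi>) / \<eta> \<le> sqrt (real K)" using K0 by (intro real_le_rsqrt) (simp add: K_def)
    then show "1 + \<xi> \<le> \<eta> * sqrt K" using eta by (simp add: field_simps)
  qed (simp add: K_def)
  define s where "s = (\<lambda>n. max_degree (\<Phi> n))"
  define d where "d = (\<lambda>n. card (S n))"
  define rem where "rem = (\<lambda>n. exp (- real n / 4))"

  \<comment> \<open>All asymptotic hypotheses with a common free rate \<open>a\<close>, which is
    fixed twice later: for the size of the net and for the comparison with p^(1 -
    \<open>\<delta>\<close>).\<close>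
  have small: "\<forall>\<^sub>F n in sequentially. n > 0 \<and> p n > 2 \<and> s n \<ge> 1 \<and> 3 \<le> a * n \<and>
      ln (real (p n)) \<le> a * n \<and> s n * ln (real (p n)) \<le> a * n \<and> real (s n) \<le> a * n \<and> real (d n) \<le> a * n"
    if a: "a > 0" for a :: real
  proof -
    have e1: "\<forall>\<^sub>F n in sequentially. norm (real (s n) * ln (real (p n)) / real n) \<le> a * norm (1::real)"
      using landau_o.smallD[OF s0_small a] by (simp add: s_def)
    have e2: "\<forall>\<^sub>F n in sequentially. norm (real (d n)) \<le> a * norm (real n / real (s n))"
      using landau_o.smallD[OF d_small a] by (simp add: s_def d_def)
    have e3: "\<forall>\<^sub>F n in sequentially. p n > 2"
      by (rule eventually_compose_filterlim[OF eventually_gt_at_top p_lim])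
    have e4: "\<forall>\<^sub>F n in sequentially. real n \<ge> 3 / a" 
      using filterlim_real_sequentially by (simp add: filterlim_at_top)
    show ?thesis
      using e1 e2 e3 e4 s0_pos eventually_gt_at_top[of 0]
    proof eventually_elim
      case (elim n)
      have s1: "real (s n) \<ge> 1" using elim by (simp add: s_def)
      \<comment> \<open>From p >= 3 >= e follows log p >= 1, so s_0 and log p are both bounded by
        s_0 log p.\<close>
      have "exp 1 \<le> real (p n)" using exp_le elim by linarith
      then have ln1: "ln (real (p n)) \<ge> 1" using elim by (simp add: ln_ge_iff)
      have sl: "s n * ln (real (p n)) \<le> a * n" using elim ln1 by (simp add: field_simps)
      have "ln (real (p n)) \<le> s n * ln (real (p n))" using s1 ln1 by (simp add: mult_le_cancel_right1)
      then have t1: "ln (real (p n)) \<le> a * n" using sl by (rule order_trans)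
      have "real (s n) \<le> s n * ln (real (p n))" using s1 ln1 by (simp add: mult_le_cancel_left1)
      then have t2: "real (s n) \<le> a * n" using sl by (rule order_trans)
      have t3: "real (d n) \<le> a * n"
      proof -
        have "real (d n) \<le> a * (real n / real (s n))" using elim by simp
        also have "\<dots> \<le> a * (real n / 1)" using s1 a by (intro mult_left_mono divide_left_mono) auto
        finally show ?thesis by simp
      qed
      have t4: "3 \<le> a * n" using elim a by (simp add: field_simps)
      have t5: "n > 0" "p n > 2" "s n \<ge> 1" using elim s1 by simp_all
      show ?case by (intro conjI t1 t2 t3 t4 t5 sl)
    qed
  qed

  have rem_small: "rem \<in> o(\<lambda>n. real (p n) powr (1 - \<delta>))"
  proof (rule landau_o.smallI)
    fix c :: real assume c: "c > 0"
    \<comment> \<open>Half of the exponent n/4 beats the constant \<open>c\<close>, the other half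
      beats p^(1 - \<open>\<delta>\<close>).\<close>
    have "((\<lambda>n. exp (- real n / 8)) \<longlongrightarrow> 0) sequentially" by real_asymp
    then have "\<forall>\<^sub>F n in sequentially. exp (- real n / 8) < c"
      using c by (rule order_tendstoD)
    moreover have "1 / (8 * (\<delta> - 1)) > 0" using delta by simp
    note small[OF this]
    ultimately show "\<forall>\<^sub>F n in sequentially. norm (rem n) \<le> c * norm (real (p n) powr (1 - \<delta>))"
    proof eventually_elim
      case (elim n)
      have "(\<delta> - 1) * ln (real (p n)) \<le> (\<delta> - 1) * (1 / (8 * (\<delta> - 1)) * n)"
        using elim delta by (intro mult_left_mono) auto
      also have "\<dots> = real n / 8" using delta by (simp add: divide_simps)
      finally have "exp (- real n / 8) \<le> exp ((1 - \<delta>) * ln (real (p n)))" by (simp add: algebra_simps)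
      also have "\<dots> = real (p n) powr (1 - \<delta>)" using elim by (simp add: powr_def)
      finally have "exp (- real n / 8) * exp (- real n / 8) \<le> c * real (p n) powr (1 - \<delta>)"
        using elim c by (intro mult_mono) auto
      then show ?case by (simp add: rem_def flip: exp_add)
    qed
  qed

  \<comment> \<open>The summands are the exponents, in units of a n, of p^m (\<open>K\<close>), 2^N
    (R + R K), 3^d (2) and the constant 2 exp 2 (1). Their total is n/4, which leaves exp(-n/4) of
    the factor exp(-n/2).\<close>
  define a where "a = 1 / (4 * (K + R + R * K + 2 + 1))"
  have "R * K \<ge> 0" using R by simp
  then have den: "K + R + R * K + 2 + 1 > 0" using R by linarith
  then have a: "a > 0" by (simp add: a_def)
  have "\<forall>\<^sub>F n in sequentially. \<forall>j<p n.
       measure (M n) {\<omega> \<in> space (M n).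
         scif2 (X n \<omega>) (S n) j \<xi> (nbrs (\<Phi> n) (S n) j) \<ge> ereal ((l / 16)\<^sup>2)} \<ge> 1 - rem n"
    using small[OF a]
  proof eventually_elim
    case (elim n)
    interpret prob_space "M n" by (rule prob)
    define m where "m = K * s n"
    define N where "N = nat \<lfloor>(1 / \<epsilon>\<^sup>2 + 2) * (card (S n) + m)\<rfloor>"
    define Z where "Z = sparse_net (p n) (S n) m N"
    have m: "m > 0" using K elim by (simp add: m_def)
    have p0: "p n > 0" using elim by simp
    have finZ: "finite Z" and cardZ: "real (card Z) \<le> real (p n) ^ m * 2 ^ N * 3 ^ card (S n) * exp 2"
      unfolding Z_def using card_sparse_net[OF S_sub p0] by auto
    have L2: "scalar_prod (vec (p n) w) (vec (p n) w) = (L2_set w {..<p n})\<^sup>2" for w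
      by (simp add: scalar_prod_def L2_set_def sum_nonneg atLeast0LessThan power2_eq_square)
    have qb: "1 / L * (L2_set w {..<p n})\<^sup>2 \<le> quad_form (p n) (\<Sigma> n) w"
      "quad_form (p n) (\<Sigma> n) w \<le> L * (L2_set w {..<p n})\<^sup>2" for w
      using quad_form_bounds_of_inverse_eigenvalues[OF Sigma(1) Sigma(2) Phi(1) Phi(3) L eigen[of n] p0,
          where w="vec (p n) w"]
      by (simp_all add: quad_form_def L2)
    obtain E where E: "E \<in> sets (M n)" "measure (M n) E \<le> card Z * (2 * exp (- real n / 2))"
      and good: "\<And>\<omega> z. \<omega> \<in> space (M n) - E \<Longrightarrow> z \<in> Z \<Longrightarrow>
        l * L2_set (\<lambda>i. real_of_int (z i)) {..<p n} \<le> sample_norm n (p n) (X n \<omega>) (\<lambda>i. real_of_int (z i)) \<and>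
        sample_norm n (p n) (X n \<omega>) (\<lambda>i. real_of_int (z i)) \<le> \<Lambda> * L2_set (\<lambda>i. real_of_int (z i)) {..<p n}"
      using gaussian_design_net_event[OF prob design _ L qb finZ] elim unfolding l_def \<Lambda>_def by blast
    have "card Z * (2 * exp (- real n / 2)) \<le> rem n"
    proof -
      have "real N \<le> R * (card (S n) + m)"
        unfolding N_def R_def by (rule of_nat_floor) simp
      also have "\<dots> = R * d n + R * K * s n" by (simp add: d_def m_def algebra_simps)
      also have "\<dots> \<le> R * (a * n) + R * K * (a * n)"
        using elim R by (intro add_mono mult_left_mono) auto
      finally have N: "real N \<le> R * (a * n) + R * K * (a * n)" .
      have e1: "real (p n) ^ m \<le> exp (K * (a * n))"
      proof -
        have "real (p n) ^ m = exp (m * ln (real (p n)))" using p0 by (simp add: exp_of_nat_mult)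
        also have "\<dots> \<le> exp (K * (a * n))"
          using elim by (simp add: m_def mult.assoc mult_left_mono)
        finally show ?thesis .
      qed
      have two: "(2::real) \<le> exp 1" using exp_ge_add_one_self[of 1] by simp
      have e2: "2 ^ N \<le> exp (R * (a * n) + R * K * (a * n))"
      proof -
        have "(2::real) ^ N \<le> exp 1 ^ N" using two by (intro power_mono) auto
        also have "\<dots> = exp (real N)" by (simp flip: exp_of_nat_mult)
        finally show ?thesis using N by (meson exp_le_cancel_iff order_trans)
      qed
      have e3: "3 ^ card (S n) \<le> exp (2 * (a * n))"
      proof -
        have "(3::real) \<le> exp 2" using exp_ge_add_one_self[of 2] by simp
        then have "(3::real) ^ card (S n) \<le> exp 2 ^ card (S n)" by (intro power_mono) auto
        also have "\<dots> = exp (2 * real (card (S n)))" by (simp add: mult.commute flip: exp_of_nat_mult)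
        also have "\<dots> \<le> exp (2 * (a * n))" using elim by (simp add: d_def)
        finally show ?thesis .
      qed
      have e4: "exp 2 * 2 \<le> exp (a * n)"
      proof -
        have "exp 2 * 2 \<le> exp 2 * exp (1::real)" using two by (intro mult_left_mono) auto
        also have "\<dots> = exp 3" by (simp flip: exp_add)
        also have "\<dots> \<le> exp (a * n)" using elim by simp
        finally show ?thesis .
      qed
      have "card Z * (2 * exp (- real n / 2)) \<le>
          real (p n) ^ m * 2 ^ N * 3 ^ card (S n) * exp 2 * (2 * exp (- real n / 2))"
        using cardZ by (intro mult_right_mono) auto
      also have "\<dots> = real (p n) ^ m * 2 ^ N * 3 ^ card (S n) * (exp 2 * 2) * exp (- real n / 2)" by simp
      also have "\<dots> \<le> exp (K * (a * n)) * exp (R * (a * n) + R * K * (a * n)) * exp (2 * (a * n)) *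
          exp (a * n) * exp (- real n / 2)"
        using e1 e2 e3 e4 by (intro mult_right_mono mult_mono) auto
      also have "\<dots> = exp ((K + R + R * K + 2 + 1) * a * n - real n / 2)"
        by (simp add: algebra_simps flip: exp_add)
      also have "(K + R + R * K + 2 + 1) * a = 1 / 4" using den by (simp add: a_def)
      also have "exp (1 / 4 * n - real n / 2) = rem n" by (simp add: rem_def)
      finally show ?thesis .
    qed
    then have Erem: "measure (M n) E \<le> rem n" using E by linarith
    \<comment> \<open>The event \<open>E\<close> is fixed before \<open>j\<close>, so the bound is
      uniform in \<open>j\<close>.\<close>
    show ?case
    proof (intro allI impI)
      fix j assume j: "j < p n"
      define T where "T = nbrs (\<Phi> n) (S n) j"
      have dimP: "dim_row (\<Phi> n) = p n" using Phi(1)[of n] by auto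
      have T: "T \<subseteq> coords (p n) (S n) j" "card T \<le> s n"
        using card_nbrs_le_max_degree[OF Phi(1) j] by (auto simp: T_def nbrs_def dimP s_def)
      define F where "F = {\<omega> \<in> space (M n). scif2 (X n \<omega>) (S n) j \<xi> T \<ge> ereal ((l / 16)\<^sup>2)}"
      have Xc: "X n \<omega> \<in> carrier_mat n (p n)" if "\<omega> \<in> space (M n)" for \<omega>
        using design[of n] that by (simp add: gaussian_design_def)
      have Xm: "measurable_mat (M n) n (p n) (X n)"
        unfolding measurable_mat_def
        using Xc gaussian_design_entry_measurable[OF prob design] by simp
      \<comment> \<open>A non-measurable set has \<open>measure\<close> 0, so the lower bound on the
        probability really depends on this.\<close>
      have F: "F \<in> sets (M n)" unfolding F_def by (rule sets_scif2_ge[OF Xm])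
      have "(1 + \<xi>) * sqrt (s n) \<le> \<eta> * sqrt K * sqrt (s n)"
        using K by (intro mult_right_mono) auto
      then have eta1: "(1 + \<xi>) * sqrt (s n) \<le> \<eta> * sqrt m" by (simp add: m_def real_sqrt_mult)
      have "space (M n) - E \<subseteq> F"
      proof
        fix \<omega> assume \<omega>: "\<omega> \<in> space (M n) - E"
        have "ereal ((l / 16)\<^sup>2) \<le> scif2 (X n \<omega>) (S n) j \<xi> T"
        proof (rule scif2_ge_of_net[OF Xc S_sub T m _ _ xi eps eta1 eta(2,3)])
          show "l * L2_set (\<lambda>i. real_of_int (z i)) {..<p n} \<le> sample_norm n (p n) (X n \<omega>) (\<lambda>i. real_of_int (z i)) \<and>
              sample_norm n (p n) (X n \<omega>) (\<lambda>i. real_of_int (z i)) \<le> \<Lambda> * L2_set (\<lambda>i. real_of_int (z i)) {..<p n}"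
            if "z \<in> sparse_net (p n) (S n) m (nat \<lfloor>(1 / \<epsilon>\<^sup>2 + 2) * (card (S n) + m)\<rfloor>)" for z
            using good[OF \<omega>] that by (simp add: Z_def N_def)
        qed (use \<omega> elim l \<Lambda> in auto)
        then show "\<omega> \<in> F" using \<omega> by (simp add: F_def)
      qed
      then have "measure (M n) (space (M n) - E) \<le> measure (M n) F"
        using F by (intro finite_measure_mono)
      then show "1 - rem n \<le> measure (M n) {\<omega> \<in> space (M n).
          scif2 (X n \<omega>) (S n) j \<xi> (nbrs (\<Phi> n) (S n) j) \<ge> ereal ((l / 16)\<^sup>2)}"
        using prob_compl[OF E(1)] Erem by (simp add: F_def T_def)
    qed
  qed
  moreover have "(l / 16)\<^sup>2 > 0" using l by simp
  ultimately show ?thesis using rem_small by blast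
qed

end
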